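(* There is an absolute constant $C>0$ such that the following holds. Let $\mathcal{F}_1,\dots,\mathcal{F}_t$ be set systems on an $n$-point ground set $V$, and let $\mathcal{F}$ be a set system on $V$ such that for each $F\in\mathcal{F}$ there are pairwise disjoint sets $F_1\in\mathcal{F}_1,\dots,F_t\in\mathcal{F}_t$ with $F=F_1\cup\cdots\cup F_t$. Then \[ \operatorname{herdisc}\mathcal{F}\le C\sqrt{\log|\mathcal{F}|}\sum_{i=1}^t(\log|\mathcal{F}_i|)\operatorname{herdisc}\mathcal{F}_i . \]
   Context: For a set system $\mathcal{F}$ on ground set $V$, $\operatorname{disc}\mathcal{F}=\min_{x\in\{-1,1\}^V}\max_{F\in\mathcal{F}}\bigl|\sum_{v\in F}x_v\bigr|$, and $\operatorname{herdisc}\mathcal{F}=\max_{J\subseteq V}\operatorname{disc}(\mathcal{F}|_J)$, where $\mathcal{F}|_J=\{F\cap J:F\in\mathcal{F}\}$.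
   Formalization: The formal theorem assumes |F| ≥ 2 and every |F_i| ≥ 2: with log 1 = 0 the claim fails for t = 1, F = F_1 = {{v}}. If |F| ≥ 2 and some |F_i| = 1, the claim follows by replacing the one-set systems by {A, ∅}, with A the union of their sets, and doubling C. *)

theory Defs
  imports Complex_Main "HOL-Library.FuncSet"
begin

definition colsum :: "('a \<Rightarrow> int) \<Rightarrow> 'a set \<Rightarrow> int" where
  "colsum x F = (\<Sum>v\<in>F. x v)"

text \<open>Discrepancy of the set system FF on the (finite) ground set V:
  minimum over colourings x : V -> {-1,1} of the maximum over F in FF of
  the absolute signed sum (maximum over the empty family taken as 0).\<close>
definition disc :: "'a set \<Rightarrow> 'a set set \<Rightarrow> int" where
  "disc V FF = Min ((\<lambda>x. Max (insert 0 ((\<lambda>F. \<bar>colsum x F\<bar>) ` FF))) ` (V \<rightarrow>\<^sub>E {-1, 1}))"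

definition restr :: "'a set set \<Rightarrow> 'a set \<Rightarrow> 'a set set" where
  "restr FF J = (\<lambda>F. F \<inter> J) ` FF"

definition herdisc :: "'a set \<Rightarrow> 'a set set \<Rightarrow> int" where
  "herdisc V FF = Max ((\<lambda>J. disc J (restr FF J)) ` Pow V)"

end

(*
A factorisation A = U W of a 0/1 matrix with all rows of U and all columns of W of squared length at
most K is the link between hereditary discrepancy and unions (the gamma_2 norm of Matousek, Nikolov
and Talwar).

(1) Factorisations add up: if every set of FF is a disjoint union of sets from Fs 1, ..., Fs t, then
the incidence matrix of FF is a sum of matrices whose rows are rows of the incidence matrices of the
Fs i, and the values K add.

(2) A factorisation with value K gives discrepancy O(K sqrt (log |FF|)): the Gram-Schmidt walk of
Bansal, Dadush, Garg and Lovett yields a subgaussian signed sum of the columns of W. It is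
derandomised here by following, for a weighted sum of exponentials, the better of the two steps.

(3) Hereditary discrepancy h of m sets gives a factorisation with K = O(h log m). By a minimax
argument it suffices to factor on average with respect to weights on rows and columns. In the
weighted norm the columns can be approximated by k-dimensional subspaces with mean square error
O(h^2 / k): otherwise a greedy choice of columns followed by an averaging over rows finds a k x k
submatrix with determinant larger than (2 h + 1)^k, which contradicts the bound of Lovasz, Spencer and
Vesztergombi. The projections on such subspaces of dimensions 1, 2, 4, ..., m telescope into O(log m)
pieces, each of which contributes O(h).
*)

theory Submission
  imports Defs "Jordan_Normal_Form.Determinant" "HOL-Probability.Hoeffding"
begin

section \<open>Integer lattices and the determinant lower bound\<close>

text \<open>Good colourings of the systems \<open>Fs i\<close> cannot be combined into one of
  \<open>FF\<close>: they are different colourings, and nothing makes a single one good for all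
  systems at once. A factorisation certifies low hereditary discrepancy without naming a colouring,
  so certificates of different systems can be superposed. The logarithms come from the two
  conversions: each \<open>Fs i\<close> pays one for its number of dyadic scales of rank, and
  \<open>FF\<close> pays the square root of one for controlling all its rows by a single subgaussian
  vector. Two classical tools appear in finite form. The volume argument behind the determinant
  bound becomes a count of representatives modulo an integer lattice, and the duality of the
  semidefinite program for gamma_2 becomes a descent on a quadratic penalty over a convex set that
  is not assumed closed. The final constant is \<open>3888 = 8 * 3 * (36 * 9 / 2)\<close>: 8 from
  the signing, 3 from minimax, 36 from balancing rank against error on one scale, and 9/2 from
  passing from the number of scales to the natural logarithm.\<close>

lemma sum_lessThan_remove:
  fixes f :: "nat \<Rightarrow> 'b::ab_group_add"
  assumes "j < n"
  shows "(\<Sum>i<n. f i) = f j + (\<Sum>i<n - 1. f (if i < j then i else Suc i))"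
proof -
  have "(\<Sum>i\<in>{..<n} - {j}. f i) = (\<Sum>i<n - 1. f (if i < j then i else Suc i))"
    by (rule sum.reindex_bij_witness[of _ "\<lambda>i. if i < j then i else Suc i" "\<lambda>i. if i < j then i else i - 1"])
       (use assms in auto)
  then show ?thesis
    using assms by (simp add: sum.remove[of "{..<n}" j])
qed

text \<open>A nonzero determinant is, up to sign, the index of the lattice spanned by the columns.
  Euclid's algorithm on the first row, by column operations that change neither lattice nor
  determinant, leaves at most one nonzero entry \<open>d\<close> there. The first coordinate then
  sorts \<open>R\<close> into residue classes modulo \<open>d\<close>, and each class yields a cover
  for the minor.\<close>

lemma det_le_card_of_lattice_cover:
  fixes A :: "int mat" and R :: "(nat \<Rightarrow> int) set"
  assumes "A \<in> carrier_mat k k" "finite R"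
    and "\<And>z :: nat \<Rightarrow> int. \<exists>r\<in>R. \<exists>x. \<forall>i<k. z i = r i + (\<Sum>j<k. A $$ (i, j) * x j)"
  shows "\<bar>Determinant.det A\<bar> \<le> int (card R)"
  using assms
proof (induction k arbitrary: A R)
  case 0
  then obtain r where "r \<in> R" by blast
  with 0 have "card R \<ge> 1"
    by (metis One_nat_def Suc_leI card_gt_0_iff empty_iff)
  then show ?case using 0(1) by simp
next
  case (Suc k)
  from Suc.prems show ?case
  proof (induction "\<Sum>j<Suc k. nat \<bar>A $$ (0, j)\<bar>" arbitrary: A rule: less_induct)
    case less
    note A = \<open>A \<in> carrier_mat (Suc k) (Suc k)\<close> and fin = \<open>finite R\<close> and cov = less.prems(3)
    show ?case
    proof (cases "\<exists>j<Suc k. \<exists>l<Suc k. j \<noteq> l \<and> \<bar>A $$ (0, l)\<bar> \<le> \<bar>A $$ (0, j)\<bar> \<and> A $$ (0, l) \<noteq> 0")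
      case True
      then obtain j l where jl: "j < Suc k" "l < Suc k" "j \<noteq> l"
        "\<bar>A $$ (0, l)\<bar> \<le> \<bar>A $$ (0, j)\<bar>" "A $$ (0, l) \<noteq> 0" by blast
      \<comment> \<open>The sign is chosen so that adding \<open>a\<close> times column
        \<open>l\<close> lowers the absolute value of entry \<open>j\<close> by that of entry
        \<open>l\<close>; the row sum of the inner induction drops.\<close>
      define a where "a = - (sgn (A $$ (0, l)) * sgn (A $$ (0, j)))"
      define B where "B = addcol a j l A"
      have B: "B \<in> carrier_mat (Suc k) (Suc k)" using A by (auto simp: B_def mat_addcol_def)
      have Bix: "B $$ (i, c) = (if c = j then a * A $$ (i, l) + A $$ (i, j) else A $$ (i, c))"
        if "i < Suc k" "c < Suc k" for i c
        using that A jl by (simp add: B_def)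
      have lt: "nat \<bar>B $$ (0, j)\<bar> < nat \<bar>A $$ (0, j)\<bar>"
        using jl by (simp add: Bix a_def sgn_if) linarith
      have "(\<Sum>c<Suc k. nat \<bar>B $$ (0, c)\<bar>) < (\<Sum>c<Suc k. nat \<bar>A $$ (0, c)\<bar>)"
        by (rule sum_strict_mono_ex1) (use jl lt in \<open>auto simp: Bix intro!: bexI[of _ j]\<close>)
      moreover have "\<exists>r\<in>R. \<exists>x. \<forall>i<Suc k. z i = r i + (\<Sum>c<Suc k. B $$ (i, c) * x c)" for z :: "nat \<Rightarrow> int"
      proof -
        obtain r x where rx: "r \<in> R" "\<forall>i<Suc k. z i = r i + (\<Sum>c<Suc k. A $$ (i, c) * x c)"
          using cov by blast
        define y where "y = x(l := x l - a * x j)"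
        have "(\<Sum>c<Suc k. B $$ (i, c) * y c) = (\<Sum>c<Suc k. A $$ (i, c) * x c)" if "i < Suc k" for i
        proof -
          have "(\<Sum>c<Suc k. B $$ (i, c) * y c) - (\<Sum>c<Suc k. A $$ (i, c) * x c)
             = (\<Sum>c<Suc k. (if c = j then a * A $$ (i, l) * x j else 0) + (if c = l then - a * A $$ (i, l) * x j else 0))"
            unfolding sum_subtractf[symmetric]
            by (rule sum.cong) (use that jl in \<open>auto simp: Bix y_def algebra_simps\<close>)
          also have "\<dots> = 0" using jl by (simp add: sum.distrib del: sum.lessThan_Suc)
          finally show ?thesis by simp
        qed
        then show ?thesis using rx by (intro bexI[of _ r] exI[of _ y]) auto
      qed
      ultimately have "\<bar>Determinant.det B\<bar> \<le> int (card R)"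
        using less.hyps B fin by blast
      then show ?thesis using det_addcol[OF jl(2) jl(3) A] by (simp add: B_def)
    next
      case False
      show ?thesis
      proof (cases "\<exists>j<Suc k. A $$ (0, j) \<noteq> 0")
        case False
        then have "Determinant.det A = 0"
          using laplace_expansion_row[OF A, of 0] by simp
        then show ?thesis by simp
      next
        case True
        then obtain j where j: "j < Suc k" "A $$ (0, j) \<noteq> 0" by blast
        have z: "A $$ (0, l) = 0" if "l < Suc k" "l \<noteq> j" for l
          using False j that by (metis linear)
        define d where "d = A $$ (0, j)"
        define B where "B = mat_delete A 0 j"
        have B: "B \<in> carrier_mat k k" using A by (simp add: B_def mat_delete_def)
        have Bix: "B $$ (i, c) = A $$ (Suc i, if c < j then c else Suc c)" if "i < k" "c < k" for i c
          using that A by (simp add: B_def mat_delete_def)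
        have "Determinant.det A = (\<Sum>c<Suc k. A $$ (0, c) * cofactor A 0 c)"
          using laplace_expansion_row[OF A, of 0] by simp
        also have "\<dots> = (\<Sum>c<Suc k. if c = j then d * cofactor A 0 j else 0)"
          by (rule sum.cong) (auto simp: z d_def)
        also have "\<dots> = d * cofactor A 0 j" using j by (simp del: sum.lessThan_Suc)
        finally have detA: "\<bar>Determinant.det A\<bar> = \<bar>d\<bar> * \<bar>Determinant.det B\<bar>"
          by (simp add: cofactor_def B_def abs_mult power_abs)
        define Rc where "Rc c = {r \<in> R. r 0 mod \<bar>d\<bar> = c}" for c
        have cRc: "\<bar>Determinant.det B\<bar> \<le> int (card (Rc c))" if c: "c \<in> {0..<\<bar>d\<bar>}" for c
        proof -
          \<comment> \<open>The first coordinate forces the coefficient of column \<open>j\<close>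
            to be \<open>(c - r 0) div d\<close>; \<open>g\<close> moves the contribution of that
            column to the other rows into the representative.\<close>
          define g where "g r = (\<lambda>i. r (Suc i) + A $$ (Suc i, j) * ((c - r 0) div d))" for r :: "nat \<Rightarrow> int"
          have "\<bar>Determinant.det B\<bar> \<le> int (card (g ` Rc c))"
          proof (rule Suc.IH[OF B])
            show "finite (g ` Rc c)" using fin by (simp add: Rc_def)
            fix z' :: "nat \<Rightarrow> int"
            obtain r x where rx: "r \<in> R"
              "\<And>i. i < Suc k \<Longrightarrow> case_nat c z' i = r i + (\<Sum>c<Suc k. A $$ (i, c) * x c)"
              using cov[of "case_nat c z'"] by blast
            have "(\<Sum>c<Suc k. A $$ (0, c) * x c) = (\<Sum>c<Suc k. if c = j then d * x j else 0)"
              by (rule sum.cong) (auto simp: z d_def)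
            also have "\<dots> = d * x j" using j by (simp del: sum.lessThan_Suc)
            finally have c0: "c = r 0 + d * x j" using rx(2)[of 0] by simp
            have "r 0 mod \<bar>d\<bar> = (r 0 + d * x j) mod \<bar>d\<bar>"
              by (metis abs_dvd_iff add.right_neutral dvd_triv_left mod_add_right_eq mod_eq_0_iff_dvd)
            then have "r \<in> Rc c" using rx(1) c c0 by (simp add: Rc_def)
            moreover have "(c - r 0) div d = x j" using c0 j by (simp add: d_def)
            moreover have "z' i = r (Suc i) + A $$ (Suc i, j) * x j +
                (\<Sum>l<k. B $$ (i, l) * x (if l < j then l else Suc l))" if "i < k" for i
            proof -
              have "(\<Sum>l<Suc k. A $$ (Suc i, l) * x l) = A $$ (Suc i, j) * x j +
                  (\<Sum>l<k. B $$ (i, l) * x (if l < j then l else Suc l))"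
                using sum_lessThan_remove[OF j(1), of "\<lambda>l. A $$ (Suc i, l) * x l"] that
                by (simp add: Bix del: sum.lessThan_Suc)
              then show ?thesis using rx(2)[of "Suc i"] that by simp
            qed
            ultimately show "\<exists>r\<in>g ` Rc c. \<exists>x. \<forall>i<k. z' i = r i + (\<Sum>j<k. B $$ (i, j) * x j)"
              by (intro bexI[of _ "g r"] exI[of _ "\<lambda>l. x (if l < j then l else Suc l)"] imageI)
                 (auto simp: g_def)
          qed
          also have "\<dots> \<le> int (card (Rc c))"
            using fin by (simp add: Rc_def card_image_le)
          finally show ?thesis .
        qed
        have "\<bar>d\<bar> * \<bar>Determinant.det B\<bar> = (\<Sum>c\<in>{0..<\<bar>d\<bar>}. \<bar>Determinant.det B\<bar>)"
          by simp
        also have "\<dots> \<le> (\<Sum>c\<in>{0..<\<bar>d\<bar>}. int (card (Rc c)))"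
          by (rule sum_mono) (use cRc in auto)
        also have "\<dots> = int (card (\<Union>c\<in>{0..<\<bar>d\<bar>}. Rc c))"
          by (subst card_UN_disjoint) (use fin in \<open>auto simp: Rc_def\<close>)
        also have "\<dots> \<le> int (card R)"
          using fin by (auto intro!: card_mono simp: Rc_def)
        finally show ?thesis using detA by simp
      qed
    qed
  qed
qed

text \<open>Binary digits are removed from the last one on: the entries with odd \<open>y j\<close>
  are moved up or down by a colouring of their columns, at a cost of \<open>h / 2 ^ Suc l\<close>.
  The costs form a geometric series, so any precision costs at most \<open>h\<close>.\<close>

lemma dyadic_rounding:
  fixes A :: "'r \<Rightarrow> nat \<Rightarrow> int" and h :: int
  assumes col: "\<And>J. J \<subseteq> {..<k} \<Longrightarrow> \<exists>\<xi>. (\<forall>j\<in>J. \<xi> j \<in> {-1, 1}) \<and> (\<forall>i\<in>I. \<bar>\<Sum>j\<in>J. A i j * \<xi> j\<bar> \<le> h)"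
  shows "\<exists>x :: nat \<Rightarrow> int. \<forall>i\<in>I.
    \<bar>\<Sum>j<k. of_int (A i j) * (of_int (y j) / 2 ^ l - of_int (x j))\<bar> \<le> of_int h * (1 - 1 / 2 ^ l :: real)"
proof (induction l arbitrary: y)
  case 0
  show ?case by (rule exI[of _ y]) simp
next
  case (Suc l)
  define J where "J = {j. j < k \<and> odd (y j)}"
  obtain \<xi> where \<xi>: "\<And>j. j \<in> J \<Longrightarrow> \<xi> j \<in> {-1, 1}" "\<And>i. i \<in> I \<Longrightarrow> \<bar>\<Sum>j\<in>J. A i j * \<xi> j\<bar> \<le> h"
  proof -
    have "J \<subseteq> {..<k}" by (auto simp: J_def)
    from col[OF this] show ?thesis using that by blast
  qed
  define y' where "y' j = (y j + (if j \<in> J then \<xi> j else 0)) div 2" for j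
  have y': "2 * y' j = y j + (if j \<in> J then \<xi> j else 0)" if "j < k" for j
  proof -
    have "even (y j + (if j \<in> J then \<xi> j else 0))"
      using that \<xi>(1)[of j] by (auto simp: J_def)
    then show ?thesis by (simp add: y'_def)
  qed
  have y'r: "of_int (y j) / 2 ^ Suc l = of_int (y' j) / 2 ^ l - (if j \<in> J then of_int (\<xi> j) else 0) / (2 ^ Suc l :: real)"
    if "j < k" for j
    using arg_cong[OF y'[OF that], of real_of_int] by (auto simp: field_simps)
  obtain x where x: "\<And>i. i \<in> I \<Longrightarrow>
    \<bar>\<Sum>j<k. of_int (A i j) * (of_int (y' j) / 2 ^ l - of_int (x j))\<bar> \<le> of_int h * (1 - 1 / 2 ^ l :: real)"
    using Suc[of y'] by blast
  have "\<bar>\<Sum>j<k. of_int (A i j) * (of_int (y j) / 2 ^ Suc l - of_int (x j))\<bar> \<le> of_int h * (1 - 1 / 2 ^ Suc l :: real)"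
    if i: "i \<in> I" for i
  proof -
    have "(\<Sum>j<k. of_int (A i j) * (of_int (y j) / 2 ^ Suc l - of_int (x j))) =
       (\<Sum>j<k. of_int (A i j) * (of_int (y' j) / 2 ^ l - of_int (x j)) -
          (if j \<in> J then of_int (A i j * \<xi> j) / (2 ^ Suc l :: real) else 0))"
      by (rule sum.cong[OF refl], subst y'r) (auto simp: algebra_simps)
    also have "\<dots> = (\<Sum>j<k. of_int (A i j) * (of_int (y' j) / 2 ^ l - of_int (x j))) -
          of_int (\<Sum>j\<in>J. A i j * \<xi> j) / (2 ^ Suc l :: real)"
    proof -
      have "{..<k} \<inter> J = J" by (auto simp: J_def)
      then show ?thesis
        by (simp add: sum_subtractf sum.inter_restrict[symmetric] sum_divide_distrib del: power_Suc)
    qed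
    also have "\<bar>\<dots>\<bar> \<le> of_int h * (1 - 1 / 2 ^ l) + of_int h / 2 ^ Suc l"
    proof -
      have "\<bar>of_int (\<Sum>j\<in>J. A i j * \<xi> j) / (2 ^ Suc l :: real)\<bar> \<le> of_int h / 2 ^ Suc l"
        using \<xi>(2)[OF i] by (simp add: abs_divide divide_right_mono flip: of_int_abs del: power_Suc of_int_sum)
      then show ?thesis using x[OF i] by linarith
    qed
    also have "\<dots> = of_int h * (1 - 1 / 2 ^ Suc l)" by (simp add: field_simps)
    finally show ?thesis .
  qed
  then show ?case by blast
qed

text \<open>An integer point \<open>z\<close> is the image of a real vector \<open>w\<close>;
  rounding \<open>w\<close> to an integer vector leaves an integer error in the box with coordinates
  between \<open>- h\<close> and \<open>h\<close>. This box therefore covers all integer points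
  modulo the lattice. Counting its points costs \<open>2 * h + 1\<close> per dimension where its
  volume would give \<open>2 * h\<close>.\<close>

theorem det_le_of_hereditary_colouring:
  fixes A :: "int mat" and h :: int
  assumes A: "A \<in> carrier_mat k k" and h: "h \<ge> 0"
    and col: "\<And>J. J \<subseteq> {..<k} \<Longrightarrow>
      \<exists>\<xi>. (\<forall>j\<in>J. \<xi> j \<in> {-1, 1}) \<and> (\<forall>i\<in>{..<k}. \<bar>\<Sum>j\<in>J. A $$ (i, j) * \<xi> j\<bar> \<le> h)"
  shows "\<bar>Determinant.det A\<bar> \<le> (2 * h + 1) ^ k"
proof (cases "Determinant.det A = 0")
  case True
  then show ?thesis using h by simp
next
  case False
  define R where "R = {..<k} \<rightarrow>\<^sub>E {-h..h}"
  have cardR: "int (card R) = (2 * h + 1) ^ k"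
    using h by (simp add: R_def card_PiE)
  have "\<bar>Determinant.det A\<bar> \<le> int (card R)"
  proof (rule det_le_card_of_lattice_cover[OF A])
    show "finite R" by (simp add: R_def finite_PiE)
    fix z :: "nat \<Rightarrow> int"
    define D where "D = real_of_int (Determinant.det A)"
    define w where "w j = (\<Sum>i<k. of_int (adj_mat A $$ (j, i) * z i)) / D" for j
    have D: "D \<noteq> 0" using False by (simp add: D_def)
    note adj = adj_mat[OF A]
    have adjix: "(\<Sum>j<k. A $$ (i, j) * adj_mat A $$ (j, l)) = (if i = l then Determinant.det A else 0)"
      if "i < k" "l < k" for i l
    proof -
      have "(A * adj_mat A) $$ (i, l) = (\<Sum>j<k. A $$ (i, j) * adj_mat A $$ (j, l))"
        using that A adj(1) by (simp add: scalar_prod_def atLeast0LessThan)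
      then show ?thesis using adj(2) that by (auto split: if_splits)
    qed
    have Aw: "(\<Sum>j<k. of_int (A $$ (i, j)) * w j) = of_int (z i)" if i: "i < k" for i
    proof -
      have "(\<Sum>j<k. of_int (A $$ (i, j)) * w j) =
         (\<Sum>j<k. \<Sum>l<k. of_int (A $$ (i, j) * adj_mat A $$ (j, l) * z l)) / D"
        by (simp add: w_def sum_distrib_left sum_divide_distrib mult.assoc)
      also have "(\<Sum>j<k. \<Sum>l<k. of_int (A $$ (i, j) * adj_mat A $$ (j, l) * z l)) =
          real_of_int (\<Sum>l<k. (\<Sum>j<k. A $$ (i, j) * adj_mat A $$ (j, l)) * z l)"
        by (subst sum.swap) (simp add: sum_distrib_right)
      also have "(\<Sum>l<k. (\<Sum>j<k. A $$ (i, j) * adj_mat A $$ (j, l)) * z l) =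
          (\<Sum>l<k. if l = i then Determinant.det A * z i else 0)"
        by (rule sum.cong) (use i adjix in auto)
      also have "\<dots> = Determinant.det A * z i" using i by simp
      finally show ?thesis using D by (simp add: D_def)
    qed
    \<comment> \<open>Since \<open>M < 2 ^ l\<close>, keeping only \<open>l\<close> binary digits of
      \<open>w\<close> changes each row by less than 1. The total error is below
      \<open>h + 1\<close>, hence at most \<open>h\<close> by integrality.\<close>
    define M where "M = (\<Sum>i<k. \<Sum>j<k. \<bar>real_of_int (A $$ (i, j))\<bar>)"
    obtain l :: nat where l: "M < 2 ^ l"
      using real_arch_pow[of 2 M] by auto
    define y where "y j = \<lfloor>2 ^ l * w j\<rfloor>" for j
    obtain x where x: "\<And>i. i < k \<Longrightarrow>
       \<bar>\<Sum>j<k. of_int (A $$ (i, j)) * (of_int (y j) / 2 ^ l - of_int (x j))\<bar> \<le> of_int h * (1 - 1 / 2 ^ l :: real)"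
    proof -
      have "\<exists>x. \<forall>i\<in>{..<k}. \<bar>\<Sum>j<k. of_int (A $$ (i, j)) * (of_int (y j) / 2 ^ l - of_int (x j))\<bar>
          \<le> of_int h * (1 - 1 / 2 ^ l :: real)"
        by (rule dyadic_rounding) (rule col)
      then show ?thesis using that by blast
    qed
    define r where "r = (\<lambda>i\<in>{..<k}. z i - (\<Sum>j<k. A $$ (i, j) * x j))"
    have "\<bar>z i - (\<Sum>j<k. A $$ (i, j) * x j)\<bar> \<le> h" if i: "i < k" for i
    proof -
      have wy: "\<bar>w j - of_int (y j) / 2 ^ l\<bar> \<le> 1 / 2 ^ l" for j
      proof -
        have "\<bar>2 ^ l * w j - of_int (y j)\<bar> \<le> 1" unfolding y_def by linarith
        moreover have "w j - of_int (y j) / 2 ^ l = (2 ^ l * w j - of_int (y j)) / 2 ^ l"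
          by (simp add: field_simps)
        ultimately show ?thesis by (simp add: divide_right_mono)
      qed
      have "\<bar>\<Sum>j<k. of_int (A $$ (i, j)) * (w j - of_int (y j) / 2 ^ l)\<bar>
          \<le> (\<Sum>j<k. \<bar>of_int (A $$ (i, j))\<bar> * (1 / 2 ^ l))"
        by (rule order_trans[OF sum_abs]) (unfold abs_mult, intro sum_mono mult_left_mono wy abs_ge_zero)
      also have "\<dots> = (\<Sum>j<k. \<bar>of_int (A $$ (i, j))\<bar>) / 2 ^ l"
        by (simp add: sum_divide_distrib)
      also have "\<dots> \<le> M / 2 ^ l"
        unfolding M_def using i
        by (intro divide_right_mono member_le_sum[of i "{..<k}" "\<lambda>i. \<Sum>j<k. \<bar>real_of_int (A $$ (i, j))\<bar>"])
           (auto simp: sum_nonneg)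
      also have "\<dots> < 1" using l by (simp add: field_simps)
      finally have 1: "\<bar>\<Sum>j<k. of_int (A $$ (i, j)) * (w j - of_int (y j) / 2 ^ l)\<bar> < 1" .
      have "of_int h * (1 - 1 / 2 ^ l :: real) \<le> of_int h * 1"
        using h by (intro mult_left_mono) auto
      moreover have "real_of_int (z i - (\<Sum>j<k. A $$ (i, j) * x j)) =
          (\<Sum>j<k. of_int (A $$ (i, j)) * (w j - of_int (y j) / 2 ^ l)) +
          (\<Sum>j<k. of_int (A $$ (i, j)) * (of_int (y j) / 2 ^ l - of_int (x j)))"
        unfolding sum.distrib[symmetric] using Aw[OF i]
        by (simp add: sum_subtractf right_diff_distrib flip: distrib_left)
      ultimately have "\<bar>real_of_int (z i - (\<Sum>j<k. A $$ (i, j) * x j))\<bar> < of_int h + 1"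
        using 1 x[OF i] by linarith
      then show ?thesis by linarith
    qed
    then have "r \<in> R" by (auto simp: r_def R_def abs_le_iff) (smt (verit) abs_le_iff)+
    moreover have "\<forall>i<k. z i = r i + (\<Sum>j<k. A $$ (i, j) * x j)" by (simp add: r_def)
    ultimately show "\<exists>r\<in>R. \<exists>x. \<forall>i<k. z i = r i + (\<Sum>j<k. A $$ (i, j) * x j)" by blast
  qed
  then show ?thesis using cardR by simp
qed

section \<open>Orthogonal projections\<close>

text \<open>Gram-Schmidt with dependent vectors dropped; \<open>card E \<le> card T\<close> later
  turns a number of columns into a bound on the rank.\<close>

lemma orthonormalise:
  fixes T :: "'a::real_inner set"
  assumes "finite T"
  shows "\<exists>E. finite E \<and> card E \<le> card T \<and> span E = span T \<and>
    (\<forall>e\<in>E. norm e = 1) \<and> pairwise orthogonal E"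
  using assms
proof (induction T rule: finite_induct)
  case empty
  show ?case by (rule exI[of _ "{}"]) simp
next
  case (insert x T)
  from insert.IH obtain E where E: "finite E" "card E \<le> card T" "span E = span T"
    "\<forall>e\<in>E. norm e = 1" "pairwise orthogonal E"
    by (elim exE conjE) (rule that)
  define y where "y = x - (\<Sum>e\<in>E. inner x e *\<^sub>R e)"
  have sumE: "(\<Sum>e\<in>E. inner x e *\<^sub>R e) \<in> span E"
    by (intro span_sum span_scale span_base)
  have orth: "inner y f = 0" if "f \<in> E" for f
  proof -
    have "inner (\<Sum>e\<in>E. inner x e *\<^sub>R e) f = (\<Sum>e\<in>E. if e = f then inner x f else 0)"
      unfolding inner_sum_left
      by (rule sum.cong) (use that E in \<open>auto simp: norm_eq_1 pairwise_def orthogonal_def\<close>)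
    then show ?thesis using that E(1) by (simp add: y_def inner_diff_left)
  qed
  have xy: "span (insert x E) = span (insert y E)"
  proof (rule antisym; rule span_minimal)
    have "y + (\<Sum>e\<in>E. inner x e *\<^sub>R e) \<in> span (insert y E)"
      by (intro span_add span_base insertI1 subsetD[OF span_mono sumE]) auto
    then show "insert x E \<subseteq> span (insert y E)" by (auto simp: y_def intro: span_base)
    have "y \<in> span (insert x E)"
      unfolding y_def by (intro span_diff span_base insertI1 subsetD[OF span_mono sumE]) auto
    then show "insert y E \<subseteq> span (insert x E)" by (auto intro: span_base)
  qed auto
  have Ts: "span (insert x T) = span (insert x E)"
    unfolding span_insert E(3) ..
  show ?case
  proof (cases "y = 0")
    case True
    then have "span (insert x T) = span E"
      using Ts xy by (simp add: span_insert_0)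
    then show ?thesis
      using E insert.hyps by (intro exI[of _ E]) auto
  next
    case False
    define e where "e = y /\<^sub>R norm y"
    have e: "norm e = 1" "\<And>f. f \<in> E \<Longrightarrow> inner e f = 0" using False orth by (auto simp: e_def)
    have sp: "span (insert y E) = span (insert e E)"
    proof (rule antisym; rule span_minimal)
      have "y = norm y *\<^sub>R e" using False by (simp add: e_def)
      then have "y \<in> span (insert e E)" by (metis insertI1 span_base span_scale)
      then show "insert y E \<subseteq> span (insert e E)" by (auto intro: span_base)
      have "e \<in> span (insert y E)" unfolding e_def by (intro span_scale span_base) simp
      then show "insert e E \<subseteq> span (insert y E)" by (auto intro: span_base)
    qed auto
    have eo: "orthogonal e f" "orthogonal f e" if "f \<in> E" for f
      using e(2)[OF that] by (auto simp: orthogonal_def inner_commute)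
    from sp have "span (insert e E) = span (insert x T)" using Ts xy by simp
    then show ?thesis
      using E e(1) insert.hyps eo
      by (intro exI[of _ "insert e E"]) (auto simp: card_insert_if pairwise_insert)
  qed
qed

text \<open>Orthogonal projection on \<open>span T\<close>, chosen by its characterisation so that
  no basis of the span has to be fixed.\<close>

definition proj :: "'a::real_inner set \<Rightarrow> 'a \<Rightarrow> 'a" where
  "proj T x = (SOME y. y \<in> span T \<and> (\<forall>z\<in>span T. inner (x - y) z = 0))"

lemma proj:
  fixes x :: "'a::real_inner"
  assumes "finite T"
  shows "proj T x \<in> span T" "\<And>z. z \<in> span T \<Longrightarrow> inner (x - proj T x) z = 0"
proof -
  obtain E where E: "finite E" "span E = span T"
    "\<forall>e\<in>E. norm e = 1" "pairwise orthogonal E"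
    using orthonormalise[OF assms] by (elim exE conjE) (rule that)
  define y where "y = (\<Sum>e\<in>E. inner x e *\<^sub>R e)"
  have orth: "inner (x - y) f = 0" if "f \<in> E" for f
  proof -
    have "inner y f = (\<Sum>e\<in>E. if e = f then inner x f else 0)"
      unfolding inner_sum_left y_def
      by (rule sum.cong) (use that E in \<open>auto simp: norm_eq_1 pairwise_def orthogonal_def\<close>)
    then show ?thesis using that E(1) by (simp add: inner_diff_left)
  qed
  have "y \<in> span T" unfolding y_def E(2)[symmetric] by (intro span_sum span_scale span_base)
  moreover have "inner (x - y) z = 0" if "z \<in> span T" for z
    using that unfolding E(2)[symmetric]
    by (induction rule: span_induct) (auto simp: orth subspace_def inner_add_right)
  ultimately have "\<exists>y. y \<in> span T \<and> (\<forall>z\<in>span T. inner (x - y) z = 0)" by blast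
  from someI_ex[OF this]
  show "proj T x \<in> span T" "\<And>z. z \<in> span T \<Longrightarrow> inner (x - proj T x) z = 0"
    unfolding proj_def by blast+
qed

lemma pythagoras:
  fixes x y :: "'a::real_inner"
  assumes "inner x y = 0"
  shows "(norm (x + y))\<^sup>2 = (norm x)\<^sup>2 + (norm y)\<^sup>2"
  using assms by (simp add: power2_norm_eq_inner inner_add_left inner_add_right inner_commute)

lemma norm_proj_le:
  assumes "finite T" shows "norm (proj T x) \<le> norm x"
proof -
  have "(norm x)\<^sup>2 = (norm (x - proj T x))\<^sup>2 + (norm (proj T x))\<^sup>2"
    using pythagoras[OF proj(2)[OF assms proj(1)[OF assms]], of x x] by simp
  then show ?thesis by (smt (verit) norm_ge_zero power2_le_imp_le zero_le_power2)
qed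

lemma norm_residual_le:
  assumes "finite T" shows "norm (x - proj T x) \<le> norm x"
proof -
  have "(norm x)\<^sup>2 = (norm (x - proj T x))\<^sup>2 + (norm (proj T x))\<^sup>2"
    using pythagoras[OF proj(2)[OF assms proj(1)[OF assms]], of x x] by simp
  then show ?thesis by (smt (verit) norm_ge_zero power2_le_imp_le zero_le_power2)
qed

text \<open>\<open>d\<close> sees only the part of \<theta> that the larger span captures and the
  smaller one misses. By Pythagoras the squared length of this part is the difference of the squared
  projections, and Cauchy-Schwarz gives the rest. The walk uses this to charge each direction that
  its residual gains to a loss of projection.\<close>

lemma inner_sq_le_proj_gain:
  fixes \<theta> d :: "'a::real_inner"
  assumes "finite S" "finite S'" "span S' \<subseteq> span S" and d: "d \<in> span S" "\<And>z. z \<in> span S' \<Longrightarrow> inner d z = 0"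
  shows "(inner \<theta> d)\<^sup>2 \<le> (norm d)\<^sup>2 * ((norm (proj S \<theta>))\<^sup>2 - (norm (proj S' \<theta>))\<^sup>2)"
proof -
  define y where "y = proj S \<theta>"
  define y' where "y' = proj S' \<theta>"
  have y: "y \<in> span S" "\<And>z. z \<in> span S \<Longrightarrow> inner (\<theta> - y) z = 0"
    using proj[OF assms(1)] by (auto simp: y_def)
  have y': "y' \<in> span S'" "\<And>z. z \<in> span S' \<Longrightarrow> inner (\<theta> - y') z = 0"
    using proj[OF assms(2)] by (auto simp: y'_def)
  have 1: "inner (y - y') y' = 0"
    using y(2)[of y'] y'(2)[of y'] y'(1) assms(3) by (auto simp: inner_diff_left)
  have 2: "(norm y)\<^sup>2 = (norm (y - y'))\<^sup>2 + (norm y')\<^sup>2"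
    using pythagoras[OF 1] by simp
  have "inner \<theta> d = inner (y - y') d"
    using y(2)[OF d(1)] d(2)[OF y'(1)] by (simp add: inner_diff_left inner_diff_right inner_commute[of d])
  then have "\<bar>inner \<theta> d\<bar> \<le> norm d * norm (y - y')"
    using Cauchy_Schwarz_ineq2[of "y - y'" d] by (simp add: mult.commute)
  then have "(inner \<theta> d)\<^sup>2 \<le> (norm d * norm (y - y'))\<^sup>2"
    by (metis abs_le_square_iff abs_mult abs_norm_cancel)
  then show ?thesis using 2 by (simp add: power_mult_distrib y_def y'_def)
qed

lemma in_span_imageE:
  fixes v :: "'i \<Rightarrow> 'a::real_vector"
  assumes "x \<in> span (v ` S)" "finite S"
  obtains u where "x = (\<Sum>j\<in>S. u j *\<^sub>R v j)"
proof -
  have "span (v ` S) \<subseteq> range (\<lambda>u. \<Sum>j\<in>S. u j *\<^sub>R v j)"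
  proof (rule span_minimal)
    show "v ` S \<subseteq> range (\<lambda>u. \<Sum>j\<in>S. u j *\<^sub>R v j)"
    proof
      fix y assume "y \<in> v ` S"
      then obtain i where "i \<in> S" "y = v i" by blast
      then have "y = (\<Sum>j\<in>S. (if j = i then 1 else 0) *\<^sub>R v j)"
        using assms(2) by (simp add: if_distrib[of "\<lambda>c. c *\<^sub>R _"] cong: if_cong)
      then show "y \<in> range (\<lambda>u. \<Sum>j\<in>S. u j *\<^sub>R v j)"
        by (rule range_eqI[where x = "\<lambda>j. if j = i then 1 else 0"])
    qed
    show "subspace (range (\<lambda>u. \<Sum>j\<in>S. u j *\<^sub>R v j))"
      unfolding subspace_def
    proof (intro conjI ballI allI)
      show "0 \<in> range (\<lambda>u. \<Sum>j\<in>S. u j *\<^sub>R v j)" by (rule range_eqI[of _ _ "\<lambda>_. 0"]) simp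
    next
      fix x y assume "x \<in> range (\<lambda>u. \<Sum>j\<in>S. u j *\<^sub>R v j)" "y \<in> range (\<lambda>u. \<Sum>j\<in>S. u j *\<^sub>R v j)"
      then obtain a b where "x = (\<Sum>j\<in>S. a j *\<^sub>R v j)" "y = (\<Sum>j\<in>S. b j *\<^sub>R v j)" by blast
      then show "x + y \<in> range (\<lambda>u. \<Sum>j\<in>S. u j *\<^sub>R v j)"
        by (intro range_eqI[of _ _ "\<lambda>j. a j + b j"]) (simp add: scaleR_add_left sum.distrib)
    next
      fix c x assume "x \<in> range (\<lambda>u. \<Sum>j\<in>S. u j *\<^sub>R v j)"
      then obtain a where "x = (\<Sum>j\<in>S. a j *\<^sub>R v j)" by blast
      then show "c *\<^sub>R x \<in> range (\<lambda>u. \<Sum>j\<in>S. u j *\<^sub>R v j)"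
        by (intro range_eqI[of _ _ "\<lambda>j. c * a j"]) (simp add: scaleR_sum_right)
    qed
  qed
  then show thesis using assms(1) that by blast
qed

section \<open>The Gram-Schmidt walk\<close>

text \<open>The exponential moment at \<open>a\<close> of a random sign with mean \<open>x\<close>.
  It is affine in \<open>x\<close>, which makes the averaging over a step of the walk exact.\<close>

definition tilt :: "real \<Rightarrow> real \<Rightarrow> real" where
  "tilt x a = cosh a + x * sinh a"

lemma tilt_alt: "tilt x a = (1 + x) / 2 * exp a + (1 - x) / 2 * exp (- a)"
  by (simp add: tilt_def cosh_field_def sinh_field_def field_simps)

lemma tilt_pos:
  assumes "\<bar>x\<bar> \<le> 1" shows "tilt x a > 0"
proof (cases "x = 1")
  case False
  then have "(1 - x) / 2 * exp (- a) > 0" "(1 + x) / 2 * exp a \<ge> 0" using assms by auto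
  then show ?thesis by (simp add: tilt_alt)
qed (simp add: tilt_alt)

lemma tilt_le:
  assumes "\<bar>x\<bar> \<le> 1" shows "tilt x a \<le> exp (a * x + a\<^sup>2 / 2)"
proof -
  have *: "tilt x a \<le> exp (a * x + a\<^sup>2 / 2)" if x: "\<bar>x\<bar> \<le> 1" and a: "a \<ge> 0" for x a
  proof -
    have eq: "1 + (1 + x) / 2 * (exp (2 * a) - 1) = exp a * tilt x a"
    proof -
      have "exp (2 * a) = exp a * exp a" by (simp flip: exp_add)
      then show ?thesis
        by (simp add: tilt_alt exp_minus field_simps)
    qed
    \<comment> \<open>Hoeffding's lemma: a sign of mean \<open>x\<close> is a Bernoulli variable
      with parameter \<open>(1 + x) / 2\<close>, stretched to an interval of length 2.\<close>
    have "- (2 * a) * ((1 + x) / 2) + ln (1 + (1 + x) / 2 * (exp (2 * a) - 1)) \<le> (2 * a)\<^sup>2 / 8"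
      by (rule Hoeffdings_lemma_aux) (use x a in auto)
    then have "ln (tilt x a) \<le> a * x + a\<^sup>2 / 2"
      unfolding eq using tilt_pos[OF x, of a]
      by (simp add: ln_mult power_mult_distrib field_simps)
    then show ?thesis using tilt_pos[OF x, of a] by (metis exp_ln exp_le_cancel_iff)
  qed
  show ?thesis
  proof (cases "a \<ge> 0")
    case False
    have "tilt x a = tilt (- x) (- a)" by (simp add: tilt_def)
    also have "\<dots> \<le> exp (a * x + a\<^sup>2 / 2)" using *[of "- x" "- a"] False assms by simp
    finally show ?thesis .
  qed (use assms * in blast)
qed

text \<open>\<open>m\<close> is the mean of the sign after exponential reweighting by
  \<open>a\<close>, so the quotient of the two moments is again a moment, \<open>tilt m e\<close>.
  Hoeffding bounds it, and the reweighting displaces the mean by at most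
  \<open>2 * \<bar>a\<bar>\<close>.\<close>

lemma tilt_add_le:
  assumes x: "\<bar>x\<bar> \<le> 1"
  shows "tilt x (a + e) \<le> tilt x a * exp (e * x + 2 * \<bar>a\<bar> * \<bar>e\<bar> + e\<^sup>2 / 2)"
proof -
  define m where "m = (sinh a + x * cosh a) / tilt x a"
  have t: "tilt x a > 0" by (rule tilt_pos[OF x])
  have "\<bar>sinh a + x * cosh a\<bar> \<le> tilt x a"
  proof -
    have "tilt x a - (sinh a + x * cosh a) = (1 - x) * exp (- a)"
      "tilt x a + (sinh a + x * cosh a) = (1 + x) * exp a"
      by (simp_all add: tilt_def cosh_field_def sinh_field_def field_simps)
    moreover have "(1 - x) * exp (- a) \<ge> 0" "(1 + x) * exp a \<ge> 0" using x by auto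
    ultimately show ?thesis by linarith
  qed
  then have m: "\<bar>m\<bar> \<le> 1" using t by (simp add: m_def abs_divide)
  have "tilt x (a + e) = tilt x a * cosh e + (sinh a + x * cosh a) * sinh e"
    by (simp add: tilt_def cosh_add sinh_add algebra_simps)
  also have "\<dots> = tilt x a * tilt m e"
    using t by (simp add: m_def tilt_def[of _ e] distrib_left)
  also have "\<dots> \<le> tilt x a * exp (e * m + e\<^sup>2 / 2)"
    using t tilt_le[OF m] by (intro mult_left_mono) auto
  also have "\<dots> \<le> tilt x a * exp (e * x + 2 * \<bar>a\<bar> * \<bar>e\<bar> + e\<^sup>2 / 2)"
  proof -
    have s: "\<bar>sinh a\<bar> \<le> \<bar>a\<bar> * cosh a"
    proof -
      have *: "sinh a \<le> a * cosh a" if "a \<ge> 0" for a :: real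
      proof -
        have "0 * cosh 0 - sinh 0 \<le> a * cosh a - sinh a"
          by (rule DERIV_nonneg_imp_nondecreasing[OF that])
             (auto intro!: exI derivative_eq_intros simp: algebra_simps)
        then show ?thesis by simp
      qed
      show ?thesis using *[of a] *[of "- a"] by (cases "a \<ge> 0") auto
    qed
    have ch: "\<bar>sinh a\<bar> \<le> cosh a" by (simp add: sinh_field_def cosh_field_def abs_le_iff field_simps)
    have "(1 - \<bar>x\<bar>) * cosh a \<le> tilt x a"
    proof -
      have "\<bar>x * sinh a\<bar> \<le> \<bar>x\<bar> * cosh a" using ch by (simp add: abs_mult mult_left_mono)
      then show ?thesis by (simp add: tilt_def algebra_simps abs_le_iff)
    qed
    then have "(1 - \<bar>x\<bar>) * \<bar>sinh a\<bar> \<le> \<bar>a\<bar> * tilt x a"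
      using mult_left_mono[OF s, of "1 - \<bar>x\<bar>"] mult_left_mono[of "(1 - \<bar>x\<bar>) * cosh a" "tilt x a" "\<bar>a\<bar>"] x
      by (simp add: algebra_simps)
    then have "(1 + \<bar>x\<bar>) * ((1 - \<bar>x\<bar>) * \<bar>sinh a\<bar>) \<le> 2 * (\<bar>a\<bar> * tilt x a)"
      using x by (intro mult_mono[of "1 + \<bar>x\<bar>" 2]) auto
    moreover have "(1 + \<bar>x\<bar>) * (1 - \<bar>x\<bar>) = 1 - x\<^sup>2" by (simp add: algebra_simps power2_eq_square)
    ultimately have num: "(1 - x\<^sup>2) * \<bar>sinh a\<bar> \<le> 2 * \<bar>a\<bar> * tilt x a"
      by (metis mult.assoc)
    have "m - x = (1 - x\<^sup>2) * sinh a / tilt x a"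
      using t by (simp add: m_def field_simps power2_eq_square) (simp add: tilt_def algebra_simps)
    moreover have "x\<^sup>2 \<le> 1" using x by (simp add: abs_square_le_1)
    ultimately have "\<bar>m - x\<bar> = (1 - x\<^sup>2) * \<bar>sinh a\<bar> / tilt x a"
      using t by (simp add: abs_mult abs_divide)
    then have "\<bar>m - x\<bar> \<le> 2 * \<bar>a\<bar>"
      using num t by (simp add: pos_divide_le_eq)
    then have "\<bar>e * (m - x)\<bar> \<le> \<bar>e\<bar> * (2 * \<bar>a\<bar>)"
      unfolding abs_mult by (intro mult_left_mono) auto
    then have "e * m \<le> e * x + 2 * \<bar>a\<bar> * \<bar>e\<bar>"
      by (simp add: right_diff_distrib abs_le_iff algebra_simps)
    then show ?thesis using t by simp
  qed
  finally show ?thesis .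
qed

text \<open>Bound for the exponential moment of the remaining walk: \<open>x\<close> is the pivot's colour,
  \<open>a\<close> and \<open>r\<close> are the component of \<open>\<theta>\<close> along, and the squared length of, the residual of the pivot
  vector, and \<open>q\<close> is the squared length of the projection of \<open>\<theta>\<close> on the non-pivot span. The term
  \<open>(1 - r) a\<^sup>2\<close> pays for the growth of the residual when a non-pivot vector is frozen.\<close>
definition walk_pot :: "real \<Rightarrow> real \<Rightarrow> real \<Rightarrow> real \<Rightarrow> real" where
  "walk_pot x a r q = tilt x a * exp (- a * x + (1 - r) * a\<^sup>2 + 6 * q)"

text \<open>Freezing a non-pivot vector enlarges the residual by an orthogonal piece of squared
  length \<open>s\<close> whose inner product with \<theta> is \<open>e\<close>. The cross term
  \<open>\<bar>a\<bar> * \<bar>e\<bar>\<close> of the new moment is paid for by the drop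
  \<open>s * a\<^sup>2\<close> of the reserve \<open>(1 - r) * a\<^sup>2\<close>, through the
  inequality of the means.\<close>

lemma walk_pot_switch:
  assumes x: "\<bar>x\<bar> \<le> 1" and "e\<^sup>2 \<le> s * (q - q')" "0 \<le> r" "0 \<le> s" "r + s \<le> 1" "q' \<le> q"
  shows "walk_pot x (a + e) (r + s) q' \<le> walk_pot x a r q"
proof -
  define D where "D = q - q'"
  have D: "D \<ge> 0" "e\<^sup>2 \<le> s * D" using assms by (auto simp: D_def)
  have s1: "s \<le> 1" using assms by simp
  have e2: "e\<^sup>2 \<le> D" using D s1 assms(4) mult_left_le_one_le[of D s] by linarith
  have 1: "16 * X \<le> Y" if "X \<le> Z" "Y - 16 * Z = W\<^sup>2" for X Y Z W :: real
    using that zero_le_power2[of W] by linarith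
  have 2: "(\<bar>a\<bar> * \<bar>e\<bar>)\<^sup>2 \<le> a\<^sup>2 * (s * D)" using D by (simp add: power_mult_distrib mult_left_mono)
  have 3: "(s * a\<^sup>2 + 4 * D)\<^sup>2 - 16 * (a\<^sup>2 * (s * D)) = (s * a\<^sup>2 - 4 * D)\<^sup>2"
    by (simp add: power2_eq_square algebra_simps)
  have "(4 * (\<bar>a\<bar> * \<bar>e\<bar>))\<^sup>2 \<le> (s * a\<^sup>2 + 4 * D)\<^sup>2"
    using 1[OF 2 3] by (simp add: power_mult_distrib)
  \<comment> \<open>The exponent has to absorb \<open>4 * (\<bar>a\<bar> * \<bar>e\<bar>) + 3 / 2 *
    e\<^sup>2 - s * a\<^sup>2\<close>, which is at most \<open>(4 + 3 / 2) * D\<close>. The factor 6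
    in the potential is this 5.5 rounded up.\<close>
  then have ae: "4 * (\<bar>a\<bar> * \<bar>e\<bar>) \<le> s * a\<^sup>2 + 4 * D"
    by (rule power2_le_imp_le) (use D assms in auto)
  have "(1 - (r + s)) * (a + e)\<^sup>2 = (1 - (r + s)) * a\<^sup>2 + (1 - (r + s)) * (2 * (a * e) + e\<^sup>2)"
    by (simp add: power2_eq_square algebra_simps)
  also have "\<dots> \<le> (1 - (r + s)) * a\<^sup>2 + (2 * (\<bar>a\<bar> * \<bar>e\<bar>) + e\<^sup>2)"
  proof -
    have "2 * (a * e) + e\<^sup>2 \<le> 2 * (\<bar>a\<bar> * \<bar>e\<bar>) + e\<^sup>2"
      using abs_ge_self[of "a * e"] by (simp add: abs_mult)
    then have "(1 - (r + s)) * (2 * (a * e) + e\<^sup>2) \<le> (1 - (r + s)) * (2 * (\<bar>a\<bar> * \<bar>e\<bar>) + e\<^sup>2)"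
      using assms by (intro mult_left_mono) auto
    also have "\<dots> \<le> 1 * (2 * (\<bar>a\<bar> * \<bar>e\<bar>) + e\<^sup>2)"
      using assms by (intro mult_right_mono) auto
    finally show ?thesis by simp
  qed
  finally have q: "(1 - (r + s)) * (a + e)\<^sup>2 \<le> (1 - r) * a\<^sup>2 - s * a\<^sup>2 + 2 * (\<bar>a\<bar> * \<bar>e\<bar>) + e\<^sup>2"
    by (simp add: algebra_simps)
  have "walk_pot x (a + e) (r + s) q' \<le>
      tilt x a * exp (e * x + 2 * \<bar>a\<bar> * \<bar>e\<bar> + e\<^sup>2 / 2) * exp (- (a + e) * x + (1 - (r + s)) * (a + e)\<^sup>2 + 6 * q')"
    unfolding walk_pot_def by (intro mult_right_mono tilt_add_le x) auto
  also have "\<dots> = tilt x a * exp (- a * x + 2 * \<bar>a\<bar> * \<bar>e\<bar> + e\<^sup>2 / 2 + (1 - (r + s)) * (a + e)\<^sup>2 + 6 * q')"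
    by (simp add: algebra_simps flip: exp_add)
  also have "\<dots> \<le> walk_pot x a r q"
    unfolding walk_pot_def
  proof (intro mult_left_mono iffD2[OF exp_le_cancel_iff])
    show "- a * x + 2 * \<bar>a\<bar> * \<bar>e\<bar> + e\<^sup>2 / 2 + (1 - (r + s)) * (a + e)\<^sup>2 + 6 * q' \<le> - a * x + (1 - r) * a\<^sup>2 + 6 * q"
      using q ae e2 D(1) by (simp add: D_def)
  qed (use tilt_pos[OF x, of a] in auto)
  finally show ?thesis .
qed

lemma walk_pot_start:
  assumes x: "\<bar>x\<bar> \<le> 1" and "a\<^sup>2 \<le> r * (q - q')" "0 \<le> r" "r \<le> 1" "q' \<le> q"
  shows "walk_pot x a r q' \<le> exp (6 * q)"
proof -
  have "r * (q - q') \<le> 1 * (q - q')" using assms by (intro mult_right_mono) auto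
  then have "a\<^sup>2 \<le> q - q'" using assms(2) by simp
  moreover have "(1 - r) * a\<^sup>2 \<le> 1 * a\<^sup>2" using assms by (intro mult_right_mono) auto
  ultimately have "a * x + a\<^sup>2 / 2 + (- a * x + (1 - r) * a\<^sup>2 + 6 * q') \<le> 6 * q"
    using assms by simp
  have "walk_pot x a r q' \<le> exp (a * x + a\<^sup>2 / 2) * exp (- a * x + (1 - r) * a\<^sup>2 + 6 * q')"
    unfolding walk_pot_def by (intro mult_right_mono tilt_le x) auto
  also have "\<dots> = exp (a * x + a\<^sup>2 / 2 + (- a * x + (1 - r) * a\<^sup>2 + 6 * q'))" by (simp only: exp_add)
  also have "\<dots> \<le> exp (6 * q)" unfolding exp_le_cancel_iff by fact
  finally show ?thesis .
qed

lemma walk_pot_frozen: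
  assumes x: "\<bar>x\<bar> = 1" and "r \<le> 1"
  shows "exp (6 * q) \<le> walk_pot x a r q"
proof -
  have "tilt x a = exp (a * x)"
    using x by (cases "x = 1") (auto simp: tilt_alt abs_if split: if_splits)
  then have "walk_pot x a r q = exp ((1 - r) * a\<^sup>2 + 6 * q)"
    by (simp add: walk_pot_def algebra_simps flip: exp_add)
  then show ?thesis using assms by simp
qed

text \<open>\<open>exp (d * a)\<close> cancels the change of \<open>exp (- a * x)\<close>, and what
  remains is affine in the colour of the pivot; a displacement of mean 0 thus preserves the average
  exactly.\<close>

lemma walk_pot_martingale:
  assumes "\<alpha> + \<beta> = 1" "\<alpha> * d + \<beta> * d' = 0"
  shows "\<alpha> * (exp (d * a) * walk_pot (x + d) a r q) + \<beta> * (exp (d' * a) * walk_pot (x + d') a r q) = walk_pot x a r q"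
proof -
  define Z where "Z = exp (- a * x + (1 - r) * a\<^sup>2 + 6 * q)"
  have *: "exp (d * a) * walk_pot (x + d) a r q = tilt (x + d) a * Z" for d
    unfolding walk_pot_def Z_def by (simp add: algebra_simps flip: exp_add)
  have "\<alpha> * tilt (x + d) a + \<beta> * tilt (x + d') a = (\<alpha> + \<beta>) * tilt x a + (\<alpha> * d + \<beta> * d') * sinh a"
    by (simp add: tilt_def algebra_simps)
  then have "(\<alpha> * tilt (x + d) a + \<beta> * tilt (x + d') a) * Z = tilt x a * Z"
    using assms by simp
  then show ?thesis unfolding * by (simp add: walk_pot_def Z_def algebra_simps)
qed

section \<open>The walk and its derandomisation\<close>

lemma step_to_boundary:
  fixes x u :: "'i \<Rightarrow> real"
  assumes S: "finite S" and x: "\<And>j. j \<in> S \<Longrightarrow> \<bar>x j\<bar> < 1" and p: "p \<in> S" "u p \<noteq> 0"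
  obtains d where "d > 0" "\<And>j. j \<in> S \<Longrightarrow> \<bar>x j + d * u j\<bar> \<le> 1" "\<exists>j\<in>S. \<bar>x j + d * u j\<bar> = 1"
proof -
  define f where "f j = (1 - sgn (u j) * x j) / \<bar>u j\<bar>" for j
  define N where "N = {j \<in> S. u j \<noteq> 0}"
  have N: "finite N" "N \<noteq> {}" using S p by (auto simp: N_def)
  define d where "d = Min (f ` N)"
  obtain j0 where j0: "j0 \<in> N" "d = f j0"
  proof -
    have "d \<in> f ` N" unfolding d_def using N by (intro Min_in) auto
    then show ?thesis using that by blast
  qed
  have le: "d \<le> f j" if "j \<in> N" for j using that N by (simp add: d_def)
  have fpos: "f j > 0" if "j \<in> N" for j
    using that x[of j] by (auto simp: f_def N_def sgn_if abs_less_iff)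
  have d: "d > 0" using j0 fpos by simp
  show thesis
  proof
    show "d > 0" by (rule d)
    show "\<bar>x j + d * u j\<bar> \<le> 1" if "j \<in> S" for j
    proof (cases "u j = 0")
      case False
      then have "d * \<bar>u j\<bar> \<le> 1 - sgn (u j) * x j"
        using le[of j] that by (simp add: N_def f_def field_simps)
      moreover have "d * \<bar>u j\<bar> > 0" using d False by simp
      ultimately show ?thesis using x[OF that] False by (cases "u j > 0") (auto simp: abs_le_iff abs_less_iff)
    qed (use x[OF that] in simp)
    show "\<exists>j\<in>S. \<bar>x j + d * u j\<bar> = 1"
    proof
      show "j0 \<in> S" using j0 by (simp add: N_def)
      have "u j0 \<noteq> 0" using j0 by (simp add: N_def)
      then have "d * \<bar>u j0\<bar> = 1 - sgn (u j0) * x j0" using j0 by (simp add: f_def)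
      then show "\<bar>x j0 + d * u j0\<bar> = 1" using \<open>u j0 \<noteq> 0\<close> by (cases "u j0 > 0") (auto simp: abs_if)
    qed
  qed
qed

locale gram_schmidt_walk =
  fixes v :: "'i \<Rightarrow> 'a::real_inner" and \<theta> :: "'k \<Rightarrow> 'a" and K :: "'k set"
begin

text \<open>Deterministic substitute for a bound \<open>B\<close> on the exponential moments of a
  random completion of \<open>x\<close>: only a weighted sum over \<open>k\<close> is controlled,
  which one of two steps always preserves. The weights \<open>c\<close> absorb the factors collected
  by earlier steps.\<close>

definition completable :: "'i set \<Rightarrow> ('i \<Rightarrow> real) \<Rightarrow> ('k \<Rightarrow> real) \<Rightarrow> ('k \<Rightarrow> real) \<Rightarrow> bool" where
  "completable S x c B \<longleftrightarrow> (\<exists>y. (\<forall>j\<in>S. y j \<in> {-1, 1}) \<and>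
     (\<Sum>k\<in>K. c k * exp (inner (\<theta> k) (\<Sum>j\<in>S. (y j - x j) *\<^sub>R v j))) \<le> (\<Sum>k\<in>K. c k * B k))"

lemma completable_mono:
  assumes "completable S x c B" "\<And>k. k \<in> K \<Longrightarrow> B k \<le> B' k" "\<And>k. k \<in> K \<Longrightarrow> 0 \<le> c k"
  shows "completable S x c B'"
proof -
  have "(\<Sum>k\<in>K. c k * B k) \<le> (\<Sum>k\<in>K. c k * B' k)"
    by (intro sum_mono mult_left_mono assms)
  with assms(1) show ?thesis unfolding completable_def by (meson order_trans)
qed

lemma completable_frozen:
  assumes "completable (S - {j}) x c B" "j \<in> S" "finite S" "\<bar>x j\<bar> = 1"
  shows "completable S x c B"
proof -
  obtain y where y: "\<forall>i\<in>S - {j}. y i \<in> {-1, 1}"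
     "(\<Sum>k\<in>K. c k * exp (inner (\<theta> k) (\<Sum>i\<in>S - {j}. (y i - x i) *\<^sub>R v i))) \<le> (\<Sum>k\<in>K. c k * B k)"
    using assms(1) unfolding completable_def by blast
  define y' where "y' = y(j := x j)"
  have "(\<Sum>i\<in>S. (y' i - x i) *\<^sub>R v i) = (\<Sum>i\<in>S - {j}. (y i - x i) *\<^sub>R v i)"
    using assms(2,3) by (simp add: sum.remove[of S j] y'_def)
  moreover have "\<forall>i\<in>S. y' i \<in> {-1, 1}"
    using y(1) assms(4) by (auto simp: y'_def abs_if split: if_splits)
  ultimately show ?thesis unfolding completable_def using y(2) by (intro exI[of _ y']) simp
qed

text \<open>The mean of the two outcomes with weights \<alpha> and \<beta> obeys the bound, so the
  smaller one does. \<open>w\<close> is the direction in which the signed sum moves.\<close>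

lemma completable_step:
  assumes plus: "completable S (\<lambda>j. x j + d * u j) (\<lambda>k. c k * exp (d * inner (\<theta> k) w)) B1"
    and minus: "completable S (\<lambda>j. x j + d' * u j) (\<lambda>k. c k * exp (d' * inner (\<theta> k) w)) B2"
    and w: "w = (\<Sum>j\<in>S. u j *\<^sub>R v j)" and c: "\<And>k. k \<in> K \<Longrightarrow> 0 \<le> c k"
    and ab: "\<alpha> \<ge> 0" "\<beta> \<ge> 0" "\<alpha> + \<beta> = 1"
    and B: "\<And>k. k \<in> K \<Longrightarrow>
      \<alpha> * (exp (d * inner (\<theta> k) w) * B1 k) + \<beta> * (exp (d' * inner (\<theta> k) w) * B2 k) \<le> B k"
  shows "completable S x c B"
proof -
  have *: "completable S x c (\<lambda>k. exp (d * inner (\<theta> k) w) * B1 k)"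
    if "completable S (\<lambda>j. x j + d * u j) (\<lambda>k. c k * exp (d * inner (\<theta> k) w)) B1" for d B1
  proof -
    obtain y where y: "\<forall>i\<in>S. y i \<in> {-1, 1}"
     "(\<Sum>k\<in>K. c k * exp (d * inner (\<theta> k) w) * exp (inner (\<theta> k) (\<Sum>i\<in>S. (y i - (x i + d * u i)) *\<^sub>R v i)))
        \<le> (\<Sum>k\<in>K. c k * exp (d * inner (\<theta> k) w) * B1 k)"
      using \<open>completable S _ _ B1\<close> unfolding completable_def by blast
    have "(\<Sum>i\<in>S. (y i - x i) *\<^sub>R v i) = d *\<^sub>R w + (\<Sum>i\<in>S. (y i - (x i + d * u i)) *\<^sub>R v i)"
      by (simp add: w scaleR_sum_right algebra_simps flip: sum.distrib)
    then show ?thesis unfolding completable_def using y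
      by (intro exI[of _ y]) (simp add: inner_add_right exp_add mult.assoc)
  qed
  define s1 where "s1 = (\<Sum>k\<in>K. c k * (exp (d * inner (\<theta> k) w) * B1 k))"
  define s2 where "s2 = (\<Sum>k\<in>K. c k * (exp (d' * inner (\<theta> k) w) * B2 k))"
  define s where "s = (\<Sum>k\<in>K. c k * B k)"
  have "\<alpha> * s1 + \<beta> * s2 = (\<Sum>k\<in>K. c k *
     (\<alpha> * (exp (d * inner (\<theta> k) w) * B1 k) + \<beta> * (exp (d' * inner (\<theta> k) w) * B2 k)))"
    by (simp add: s1_def s2_def sum_distrib_left sum.distrib[symmetric] algebra_simps)
  also have "\<dots> \<le> s" unfolding s_def by (intro sum_mono mult_left_mono B c)
  finally have "\<alpha> * s1 + \<beta> * s2 \<le> s" .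
  moreover have "\<alpha> * min s1 s2 + \<beta> * min s1 s2 \<le> \<alpha> * s1 + \<beta> * s2"
    using ab by (intro add_mono mult_left_mono) auto
  moreover have "\<alpha> * min s1 s2 + \<beta> * min s1 s2 = min s1 s2"
    using ab by (simp flip: distrib_right)
  ultimately have "s1 \<le> s \<or> s2 \<le> s" by linarith
  then show ?thesis
    using *[OF plus] *[OF minus] unfolding completable_def s1_def s2_def s_def by (meson order_trans)
qed

definition residual :: "'i set \<Rightarrow> 'i \<Rightarrow> 'a" where
  "residual S p = v p - proj (v ` S) (v p)"

definition pivot_bound :: "'i set \<Rightarrow> 'i \<Rightarrow> real \<Rightarrow> 'k \<Rightarrow> real" where
  "pivot_bound S p t k = walk_pot t (inner (\<theta> k) (residual S p)) ((norm (residual S p))\<^sup>2)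
     ((norm (proj (v ` S) (\<theta> k)))\<^sup>2)"

lemma proj_mono:
  assumes "finite S" "S' \<subseteq> S"
  shows "(norm (proj (v ` S') z))\<^sup>2 \<le> (norm (proj (v ` S) z))\<^sup>2"
proof -
  have fin: "finite (v ` S)" "finite (v ` S')" using assms finite_subset by auto
  have sub: "span (v ` S') \<subseteq> span (v ` S)" using assms by (intro span_mono) auto
  have "inner (proj (v ` S) z - proj (v ` S') z) (proj (v ` S') z) = 0"
    using proj(2)[OF fin(1), of "proj (v ` S') z" z] proj(2)[OF fin(2), of "proj (v ` S') z" z]
      proj(1)[OF fin(2), of z] sub by (auto simp: inner_diff_left)
  from pythagoras[OF this] show ?thesis by simp
qed

text \<open>Without \<open>j\<close> the residual gains a vector \<open>d\<close> orthogonal both to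
  the old residual and to the remaining span, so \<open>walk_pot_switch\<close> applies with
  \<open>s\<close> and \<open>e\<close> read off from \<open>d\<close>.\<close>

lemma pivot_bound_remove:
  assumes S: "finite S" "j \<in> S" and v: "norm (v p) \<le> 1" and t: "\<bar>t\<bar> \<le> 1"
  shows "pivot_bound (S - {j}) p t k \<le> pivot_bound S p t k"
proof -
  define S' where "S' = S - {j}"
  define w where "w = residual S p"
  define w' where "w' = residual S' p"
  define d where "d = w' - w"
  have fin: "finite (v ` S)" "finite (v ` S')" using S by (auto simp: S'_def)
  have sub: "span (v ` S') \<subseteq> span (v ` S)" by (intro span_mono) (auto simp: S'_def)
  have d_eq: "d = proj (v ` S) (v p) - proj (v ` S') (v p)"
    by (simp add: d_def w_def w'_def residual_def)
  have dS: "d \<in> span (v ` S)"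
    unfolding d_eq using proj(1)[OF fin(1)] proj(1)[OF fin(2)] sub by (intro span_diff) auto
  have d0: "inner d z = 0" if "z \<in> span (v ` S')" for z
  proof -
    have "z \<in> span (v ` S)" using that sub by blast
    then show ?thesis using proj(2)[OF fin(2) that, of "v p"] proj(2)[OF fin(1), of z "v p"]
      by (simp add: d_def w_def w'_def residual_def inner_diff_left)
  qed
  have wd: "inner w d = 0" unfolding w_def residual_def by (rule proj(2)[OF fin(1) dS])
  have w'_eq: "w' = w + d" by (simp add: d_def)
  have nw': "(norm w')\<^sup>2 = (norm w)\<^sup>2 + (norm d)\<^sup>2"
    unfolding w'_eq by (rule pythagoras[OF wd])
  have "norm w' \<le> 1"
    unfolding w'_def residual_def using norm_residual_le[OF fin(2), of "v p"] v by linarith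
  then have "(norm w')\<^sup>2 \<le> 1" by (simp add: power_le_one)
  then have "walk_pot t (inner (\<theta> k) w + inner (\<theta> k) d) ((norm w)\<^sup>2 + (norm d)\<^sup>2) ((norm (proj (v ` S') (\<theta> k)))\<^sup>2)
     \<le> walk_pot t (inner (\<theta> k) w) ((norm w)\<^sup>2) ((norm (proj (v ` S) (\<theta> k)))\<^sup>2)"
    using inner_sq_le_proj_gain[OF fin sub dS d0] nw' proj_mono[OF S(1), of S']
    by (intro walk_pot_switch t) (auto simp: S'_def)
  then show ?thesis
    unfolding pivot_bound_def S'_def[symmetric] w_def[symmetric] w'_def[symmetric] nw'
    by (simp add: w'_eq inner_add_right)
qed

lemma pivot_bound_start:
  assumes S: "finite S" "p \<in> S" and v: "norm (v p) \<le> 1" and t: "\<bar>t\<bar> \<le> 1"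
  shows "pivot_bound (S - {p}) p t k \<le> exp (6 * (norm (proj (v ` S) (\<theta> k)))\<^sup>2)"
proof -
  define S' where "S' = S - {p}"
  define w where "w = residual S' p"
  have fin: "finite (v ` S)" "finite (v ` S')" using S by (auto simp: S'_def)
  have sub: "span (v ` S') \<subseteq> span (v ` S)" by (intro span_mono) (auto simp: S'_def)
  have wS: "w \<in> span (v ` S)"
    unfolding w_def residual_def using proj(1)[OF fin(2), of "v p"] sub S
    by (intro span_diff) (auto intro: span_base)
  have w0: "inner w z = 0" if "z \<in> span (v ` S')" for z
    unfolding w_def residual_def by (rule proj(2)[OF fin(2) that])
  have "norm w \<le> 1"
    unfolding w_def residual_def using norm_residual_le[OF fin(2), of "v p"] v by linarith
  then have "(norm w)\<^sup>2 \<le> 1" by (simp add: power_le_one)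
  then show ?thesis
    unfolding pivot_bound_def S'_def[symmetric] w_def[symmetric]
    using inner_sq_le_proj_gain[OF fin sub wS w0] proj_mono[OF S(1), of S']
    by (intro walk_pot_start t) (auto simp: S'_def)
qed

text \<open>Induction on the number of non-pivot vectors. A frozen one is dropped, and a frozen
  pivot is replaced by any vector of \<open>S\<close>; if nothing is frozen, a step in either
  direction freezes a coordinate. The pivot is kept until it freezes, so that a single residual
  carries the moment bound in the meantime.\<close>

lemma walk:
  assumes "finite S" "card S = n" "p \<notin> S" "\<And>j. j \<in> insert p S \<Longrightarrow> \<bar>x j\<bar> \<le> 1"
    "\<And>j. j \<in> insert p S \<Longrightarrow> norm (v j) \<le> 1" "\<And>k. k \<in> K \<Longrightarrow> 0 \<le> c k"
  shows "completable (insert p S) x c (pivot_bound S p (x p))"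
  using assms
proof (induction n arbitrary: S p x c rule: less_induct)
  case (less n)
  note S = less.prems(1-3) and v1 = less.prems(5)
  \<comment> \<open>For arbitrary \<open>x\<close> and \<open>c\<close>, because it is also applied
    at both ends of a step, where colouring and weights have changed.\<close>
  have frozen: "completable (insert p S) x c (pivot_bound S p (x p))"
    if x: "\<And>j. j \<in> insert p S \<Longrightarrow> \<bar>x j\<bar> \<le> 1" and c: "\<And>k. k \<in> K \<Longrightarrow> 0 \<le> c k"
      and j: "j \<in> insert p S" "\<bar>x j\<bar> = 1" for x c j
  proof (cases "j = p")
    case True
    have "completable S x c (\<lambda>k. exp (6 * (norm (proj (v ` S) (\<theta> k)))\<^sup>2))"
    proof (cases "S = {}")
      case True
      then show ?thesis
        unfolding completable_def by (auto intro!: sum_mono simp: mult_le_cancel_left1 dest: c)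
    next
      case False
      then obtain p' where p': "p' \<in> S" by blast
      have "card (S - {p'}) < n" using card_Diff1_less[OF S(1) p'] S(2) by simp
      then have "completable (insert p' (S - {p'})) x c (pivot_bound (S - {p'}) p' (x p'))"
        by (rule less.IH) (use S p' x c v1 in auto)
      then have "completable S x c (pivot_bound (S - {p'}) p' (x p'))"
        using p' by (simp add: insert_absorb)
      then show ?thesis
        by (rule completable_mono) (use S p' x c v1 in \<open>auto intro!: pivot_bound_start\<close>)
    qed
    then have "completable S x c (pivot_bound S p (x p))"
    proof (rule completable_mono)
      have "norm (residual S p) \<le> 1"
        unfolding residual_def using norm_residual_le[of "v ` S" "v p"] v1[of p] S by simp
      then have "(norm (residual S p))\<^sup>2 \<le> 1" by (simp add: power_le_one)
      then show "exp (6 * (norm (proj (v ` S) (\<theta> k)))\<^sup>2) \<le> pivot_bound S p (x p) k" for k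
        unfolding pivot_bound_def using j True by (intro walk_pot_frozen) auto
    qed (rule c)
    then show ?thesis
      using completable_frozen[of "insert p S" p x c] S j True by simp
  next
    case False
    then have jS: "j \<in> S" using j by blast
    have "card (S - {j}) < n" using card_Diff1_less[OF S(1) jS] S(2) by simp
    then have "completable (insert p (S - {j})) x c (pivot_bound (S - {j}) p (x p))"
      by (rule less.IH) (use S x c v1 in auto)
    then have *: "completable (insert p (S - {j})) x c (pivot_bound S p (x p))"
      by (rule completable_mono) (use S jS x c v1 in \<open>auto intro!: pivot_bound_remove\<close>)
    have "insert p S - {j} = insert p (S - {j})" using False by auto
    then show ?thesis
      using completable_frozen[of "insert p S" j x c] * S j by simp
  qed
  show ?case
  proof (cases "\<exists>j\<in>insert p S. \<bar>x j\<bar> = 1")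
    case True
    then obtain j where "j \<in> insert p S" "\<bar>x j\<bar> = 1" ..
    with less.prems(4,6) show ?thesis by (intro frozen[of x c j])
  next
    case False
    then have x: "\<bar>x j\<bar> < 1" if "j \<in> insert p S" for j
      using less.prems(4)[OF that] that by force
    have fin: "finite (v ` S)" using S by simp
    obtain u0 where u0: "proj (v ` S) (v p) = (\<Sum>j\<in>S. u0 j *\<^sub>R v j)"
      using in_span_imageE[OF proj(1)[OF fin] S(1)] by metis
    \<comment> \<open>Coefficient 1 at the pivot and minus the coefficients of its projection
      elsewhere: the signed sum moves along the residual, orthogonally to all non-pivot
      vectors.\<close>
    define u where "u = (\<lambda>j. - u0 j)(p := 1)"
    have w: "residual S p = (\<Sum>j\<in>insert p S. u j *\<^sub>R v j)"
    proof -
      have "(\<Sum>j\<in>S. u j *\<^sub>R v j) = (\<Sum>j\<in>S. - (u0 j *\<^sub>R v j))"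
        by (rule sum.cong) (use S in \<open>auto simp: u_def\<close>)
      then show ?thesis using S by (simp add: residual_def u0 sum_negf) (simp add: u_def)
    qed
    have finp: "finite (insert p S)" and pS: "p \<in> insert p S" and up: "u p \<noteq> 0" and up': "- u p \<noteq> 0"
      using S by (simp_all add: u_def)
    obtain d where d: "d > 0" "\<And>j. j \<in> insert p S \<Longrightarrow> \<bar>x j + d * u j\<bar> \<le> 1"
      "\<exists>j\<in>insert p S. \<bar>x j + d * u j\<bar> = 1"
      by (rule step_to_boundary[of "insert p S" x p u, OF finp _ pS up]) (erule x, rule that)
    obtain d' where d': "d' > 0" "\<And>j. j \<in> insert p S \<Longrightarrow> \<bar>x j + d' * (- u j)\<bar> \<le> 1"
      "\<exists>j\<in>insert p S. \<bar>x j + d' * (- u j)\<bar> = 1"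
      by (rule step_to_boundary[of "insert p S" x p "\<lambda>j. - u j", OF finp _ pS up']) (erule x, rule that)
    have step: "completable (insert p S) (\<lambda>j. x j + \<delta> * u j)
        (\<lambda>k. c k * exp (\<delta> * inner (\<theta> k) (residual S p))) (pivot_bound S p (x p + \<delta>))"
      if \<delta>: "\<And>j. j \<in> insert p S \<Longrightarrow> \<bar>x j + \<delta> * u j\<bar> \<le> 1" "\<exists>j\<in>insert p S. \<bar>x j + \<delta> * u j\<bar> = 1" for \<delta>
    proof -
      obtain j where "j \<in> insert p S" "\<bar>x j + \<delta> * u j\<bar> = 1" using \<delta>(2) by blast
      then have "completable (insert p S) (\<lambda>j. x j + \<delta> * u j)
          (\<lambda>k. c k * exp (\<delta> * inner (\<theta> k) (residual S p))) (pivot_bound S p (x p + \<delta> * u p))"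
        using frozen[of "\<lambda>j. x j + \<delta> * u j" "\<lambda>k. c k * exp (\<delta> * inner (\<theta> k) (residual S p))" j]
          \<delta>(1) less.prems(6) by simp
      then show ?thesis by (simp add: u_def)
    qed
    \<comment> \<open>Probabilities that make the mean displacement 0; the step along
      \<open>- u\<close> enters as the displacement \<open>- d'\<close>.\<close>
    define \<alpha> where "\<alpha> = d' / (d + d')"
    define \<beta> where "\<beta> = d / (d + d')"
    have ab: "\<alpha> \<ge> 0" "\<beta> \<ge> 0" "\<alpha> + \<beta> = 1" "\<alpha> * d + \<beta> * (- d') = 0"
      using d(1) d'(1) by (auto simp: \<alpha>_def \<beta>_def add_divide_distrib[symmetric])
    show ?thesis
    proof (rule completable_step[OF step step w less.prems(6) ab(1-3)])
      show "\<alpha> * (exp (d * inner (\<theta> k) (residual S p)) * pivot_bound S p (x p + d) k) +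
         \<beta> * (exp (- d' * inner (\<theta> k) (residual S p)) * pivot_bound S p (x p + - d') k)
         \<le> pivot_bound S p (x p) k" for k
        unfolding pivot_bound_def using walk_pot_martingale[OF ab(3,4)] by (intro eq_refl)
    qed (use d d' in auto)
  qed
qed

end

text \<open>The walk from the colouring 0 with unit weights. The vectors \<open>\<theta> k\<close>
  are controlled only through the sum of their exponentials, which is all that a union bound
  uses.\<close>

theorem subgaussian_signing:
  fixes v :: "'i \<Rightarrow> 'a::real_inner" and \<theta> :: "'k \<Rightarrow> 'a"
  assumes "finite J" "\<And>j. j \<in> J \<Longrightarrow> norm (v j) \<le> 1"
  obtains y where "\<And>j. j \<in> J \<Longrightarrow> y j \<in> {-1, 1 :: real}"
    "(\<Sum>k\<in>K. exp (inner (\<theta> k) (\<Sum>j\<in>J. y j *\<^sub>R v j))) \<le> (\<Sum>k\<in>K. exp (6 * (norm (\<theta> k))\<^sup>2))"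
proof (cases "J = {}")
  case True
  show thesis 
  proof (rule that[of "\<lambda>_. 1"])
    show "(\<Sum>k\<in>K. exp (inner (\<theta> k) (\<Sum>j\<in>J. 1 *\<^sub>R v j))) \<le> (\<Sum>k\<in>K. exp (6 * (norm (\<theta> k))\<^sup>2))"
      by (rule sum_mono) (simp add: True)
  qed auto
next
  case False
  interpret gram_schmidt_walk v \<theta> K .
  obtain p where p: "p \<in> J" using False by blast
  have "completable (insert p (J - {p})) (\<lambda>_. 0) (\<lambda>_. 1) (pivot_bound (J - {p}) p 0)"
    using assms p by (intro walk[where n = "card (J - {p})" and x = "\<lambda>_. 0"]) auto
  then have "completable J (\<lambda>_. 0) (\<lambda>_. 1) (pivot_bound (J - {p}) p 0)"
    using p by (simp add: insert_absorb)
  then have "completable J (\<lambda>_. 0) (\<lambda>_. 1) (\<lambda>k. exp (6 * (norm (\<theta> k))\<^sup>2))"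
  proof (rule completable_mono)
    fix k
    have "pivot_bound (J - {p}) p 0 k \<le> exp (6 * (norm (proj (v ` J) (\<theta> k)))\<^sup>2)"
      using assms p by (intro pivot_bound_start) auto
    also have "\<dots> \<le> exp (6 * (norm (\<theta> k))\<^sup>2)"
      using assms(1) by (simp add: norm_proj_le)
    finally show "pivot_bound (J - {p}) p 0 k \<le> exp (6 * (norm (\<theta> k))\<^sup>2)" .
  qed auto
  then show thesis unfolding completable_def using that by auto
qed

section \<open>Finitely supported vectors\<close>

text \<open>An inner product space that contains every finite-dimensional Euclidean space, so that
  dimensions may vary within a proof.\<close>
typedef 'i fvec = "{f :: 'i \<Rightarrow> real. finite {i. f i \<noteq> 0}}"
  morphisms coord Abs_fvec
  by (rule exI[of _ "\<lambda>_. 0"]) simp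

setup_lifting type_definition_fvec

lemma finite_coord: "finite {i. coord x i \<noteq> 0}"
  using coord[of x] by simp

lemma fvec_eqI: "(\<And>i. coord x i = coord y i) \<Longrightarrow> x = y"
  by (simp add: coord_inject[symmetric] fun_eq_iff)

instantiation fvec :: (type) real_inner
begin

lift_definition zero_fvec :: "'a fvec" is "\<lambda>_. 0" by simp
lift_definition plus_fvec :: "'a fvec \<Rightarrow> 'a fvec \<Rightarrow> 'a fvec" is "\<lambda>f g i. f i + g i"
  subgoal for f g by (rule finite_subset[of _ "{i. f i \<noteq> 0} \<union> {i. g i \<noteq> 0}"]) auto
  done
lift_definition minus_fvec :: "'a fvec \<Rightarrow> 'a fvec \<Rightarrow> 'a fvec" is "\<lambda>f g i. f i - g i"
  subgoal for f g by (rule finite_subset[of _ "{i. f i \<noteq> 0} \<union> {i. g i \<noteq> 0}"]) auto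
  done
lift_definition uminus_fvec :: "'a fvec \<Rightarrow> 'a fvec" is "\<lambda>f i. - f i" by simp
lift_definition scaleR_fvec :: "real \<Rightarrow> 'a fvec \<Rightarrow> 'a fvec" is "\<lambda>c f i. c * f i"
  by (rule finite_subset[rotated]) auto

definition inner_fvec :: "'a fvec \<Rightarrow> 'a fvec \<Rightarrow> real" where
  "inner_fvec x y = (\<Sum>i | coord x i \<noteq> 0. coord x i * coord y i)"

definition norm_fvec :: "'a fvec \<Rightarrow> real" where "norm_fvec x = sqrt (inner x x)"
definition sgn_fvec :: "'a fvec \<Rightarrow> 'a fvec" where "sgn_fvec x = scaleR (inverse (norm x)) x"
definition dist_fvec :: "'a fvec \<Rightarrow> 'a fvec \<Rightarrow> real" where "dist_fvec x y = norm (x - y)"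
definition uniformity_fvec :: "('a fvec \<times> 'a fvec) filter" where
  "uniformity_fvec = (INF e\<in>{0<..}. principal {(x, y). dist x y < e})"
definition open_fvec :: "'a fvec set \<Rightarrow> bool" where
  "open_fvec U = (\<forall>x\<in>U. eventually (\<lambda>(x', y). x' = x \<longrightarrow> y \<in> U) uniformity)"

lemma inner_fvec_superset:
  assumes "finite I" "\<And>i. i \<notin> I \<Longrightarrow> coord x i * coord y i = 0"
  shows "inner x y = (\<Sum>i\<in>I. coord x i * coord y i)"
proof -
  have "inner x y = (\<Sum>i\<in>I \<inter> {i. coord x i \<noteq> 0}. coord x i * coord y i)"
    unfolding inner_fvec_def using assms by (intro sum.mono_neutral_right finite_coord) auto
  also have "\<dots> = (\<Sum>i\<in>I. coord x i * coord y i)"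
    using assms by (intro sum.mono_neutral_left) auto
  finally show ?thesis .
qed

instance
proof
  fix x y z :: "'a fvec" and a b :: real
  show "x + y + z = x + (y + z)" by transfer auto
  show "x + y = y + x" by transfer auto
  show "0 + x = x" by transfer auto
  show "- x + x = 0" by transfer auto
  show "x - y = x + - y" by transfer auto
  show "a *\<^sub>R (x + y) = a *\<^sub>R x + a *\<^sub>R y" by transfer (simp add: distrib_left)
  show "(a + b) *\<^sub>R x = a *\<^sub>R x + b *\<^sub>R x" by transfer (simp add: distrib_right)
  show "a *\<^sub>R b *\<^sub>R x = (a * b) *\<^sub>R x" by transfer (simp add: mult.assoc)
  show "1 *\<^sub>R x = x" by transfer simp
  show "dist x y = norm (x - y)" by (rule dist_fvec_def)
  show "sgn x = scaleR (inverse (norm x)) x" by (rule sgn_fvec_def)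
  show "(uniformity :: ('a fvec \<times> 'a fvec) filter) = (INF e\<in>{0<..}. principal {(x, y). dist x y < e})"
    by (rule uniformity_fvec_def)
  show "open U = (\<forall>x\<in>U. eventually (\<lambda>(x', y). x' = x \<longrightarrow> y \<in> U) uniformity)" for U :: "'a fvec set"
    by (rule open_fvec_def)
  show "norm x = sqrt (inner x x)" by (rule norm_fvec_def)
  define I where "I = {i. coord x i \<noteq> 0} \<union> {i. coord y i \<noteq> 0} \<union> {i. coord z i \<noteq> 0}"
  have I: "finite I" by (simp add: I_def finite_coord)
  have out: "coord x i = 0" "coord y i = 0" "coord z i = 0" if "i \<notin> I" for i
    using that by (auto simp: I_def)
  show "inner x y = inner y x"
    using I out by (subst (1 2) inner_fvec_superset[of I]) (auto simp: mult.commute)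
  show "inner (x + y) z = inner x z + inner y z"
    using I out
    by (subst (1 2 3) inner_fvec_superset[of I]) (auto simp: plus_fvec.rep_eq distrib_right sum.distrib)
  show "inner (a *\<^sub>R x) y = a * inner x y"
    using I out
    by (subst (1 2) inner_fvec_superset[of I]) (auto simp: scaleR_fvec.rep_eq sum_distrib_left mult.assoc)
  show "0 \<le> inner x x" unfolding inner_fvec_def by (intro sum_nonneg) auto
  have "inner x x = 0 \<longleftrightarrow> (\<forall>i. coord x i = 0)"
    unfolding inner_fvec_def by (subst sum_nonneg_eq_0_iff) (auto simp: finite_coord)
  also have "\<dots> \<longleftrightarrow> x = 0" by (auto simp: zero_fvec.rep_eq intro: fvec_eqI)
  finally show "(inner x x = 0) = (x = 0)" .
qed

end

definition fvec_of :: "'i set \<Rightarrow> ('i \<Rightarrow> real) \<Rightarrow> 'i fvec" where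
  "fvec_of I f = Abs_fvec (\<lambda>i. if i \<in> I then f i else 0)"

lemma coord_fvec_of: "finite I \<Longrightarrow> coord (fvec_of I f) i = (if i \<in> I then f i else 0)"
  unfolding fvec_of_def by (subst Abs_fvec_inverse) auto

lemma inner_fvec_of:
  assumes "finite I"
  shows "inner (fvec_of I f) y = (\<Sum>i\<in>I. f i * coord y i)"
  using assms by (subst inner_fvec_superset[of I]) (auto simp: coord_fvec_of)

lemma inner_fvec_of_fvec_of:
  assumes "finite I"
  shows "inner (fvec_of I f) (fvec_of I g) = (\<Sum>i\<in>I. f i * g i)"
  using assms by (simp add: inner_fvec_of coord_fvec_of)

lemma coord_add [simp]: "coord (x + y) i = coord x i + coord y i"
  by (simp add: plus_fvec.rep_eq)

lemma coord_scaleR [simp]: "coord (c *\<^sub>R x) i = c * coord x i"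
  by (simp add: scaleR_fvec.rep_eq)

lemma coord_diff [simp]: "coord (x - y) i = coord x i - coord y i"
  by (simp add: minus_fvec.rep_eq)

lemma coord_0 [simp]: "coord 0 i = 0"
  by (simp add: zero_fvec.rep_eq)

lemma coord_sum [simp]: "coord (\<Sum>j\<in>J. f j) i = (\<Sum>j\<in>J. coord (f j) i)"
  by (induction J rule: infinite_finite_induct) auto

section \<open>Low-rank approximation\<close>

text \<open>Averaged Cauchy-Binet formula. After expanding both determinants by Leibniz's formula,
  the sum over \<open>g\<close> factors into inner products of \<open>e (\<pi> i)\<close> and
  \<open>e (\<rho> i)\<close>, and only \<open>\<rho> = \<pi>\<close> survives. Each set of
  \<open>k\<close> rows occurs in all its orders, hence \<open>fact k\<close> instead of 1.\<close>

lemma sum_weighted_det_square: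
  fixes e :: "nat \<Rightarrow> 'r \<Rightarrow> real" and p :: "'r \<Rightarrow> real"
  assumes R: "finite R"
    and on: "\<And>i j. i < k \<Longrightarrow> j < k \<Longrightarrow> (\<Sum>F\<in>R. p F * (e i F * e j F)) = (if i = j then 1 else 0)"
  shows "(\<Sum>g\<in>{0..<k} \<rightarrow>\<^sub>E R. (\<Prod>i=0..<k. p (g i)) * (Determinant.det (Matrix.mat k k (\<lambda>(i, j). e j (g i))))\<^sup>2)
    = fact k"
proof -
  define P where "P = {\<pi>. \<pi> permutes {0..<k}}"
  have finP: "finite P" by (simp add: P_def finite_permutations)
  have det: "Determinant.det (Matrix.mat k k (\<lambda>(i, j). e j (g i))) = (\<Sum>\<pi>\<in>P. signof \<pi> * (\<Prod>i=0..<k. e (\<pi> i) (g i)))" for g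
    by (subst det_def'[of _ k]) (auto simp: P_def intro!: sum.cong prod.cong simp: permutes_in_image)
  have "(\<Sum>g\<in>{0..<k} \<rightarrow>\<^sub>E R. (\<Prod>i=0..<k. p (g i)) * (Determinant.det (Matrix.mat k k (\<lambda>(i, j). e j (g i))))\<^sup>2)
    = (\<Sum>g\<in>{0..<k} \<rightarrow>\<^sub>E R. \<Sum>\<pi>\<in>P. \<Sum>\<rho>\<in>P. signof \<pi> * signof \<rho> * (\<Prod>i=0..<k. p (g i) * (e (\<pi> i) (g i) * e (\<rho> i) (g i))))"
    unfolding det power2_eq_square sum_product sum_distrib_left
    by (intro sum.cong refl) (simp add: prod.distrib mult_ac sum_distrib_left)
  also have "\<dots> = (\<Sum>\<pi>\<in>P. \<Sum>\<rho>\<in>P. \<Sum>g\<in>{0..<k} \<rightarrow>\<^sub>E R. signof \<pi> * signof \<rho> * (\<Prod>i=0..<k. p (g i) * (e (\<pi> i) (g i) * e (\<rho> i) (g i))))"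
    by (subst sum.swap, intro sum.cong refl, rule sum.swap)
  also have "\<dots> = (\<Sum>\<pi>\<in>P. \<Sum>\<rho>\<in>P. if \<rho> = \<pi> then 1 else 0)"
  proof (intro sum.cong refl)
    fix \<pi> \<rho> assume mem: "\<pi> \<in> P" "\<rho> \<in> P"
    have lt: "\<pi> i < k" "\<rho> i < k" if "i < k" for i
      using mem that permutes_in_image[of \<pi> "{0..<k}" i] permutes_in_image[of \<rho> "{0..<k}" i] by (auto simp: P_def)
    have "(\<Sum>g\<in>{0..<k} \<rightarrow>\<^sub>E R. signof \<pi> * signof \<rho> * (\<Prod>i=0..<k. p (g i) * (e (\<pi> i) (g i) * e (\<rho> i) (g i))))
       = signof \<pi> * signof \<rho> * (\<Prod>i=0..<k. \<Sum>F\<in>R. p F * (e (\<pi> i) F * e (\<rho> i) F))"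
      using R by (subst prod_sum_PiE) (auto simp: sum_distrib_left)
    also have "(\<Prod>i=0..<k. \<Sum>F\<in>R. p F * (e (\<pi> i) F * e (\<rho> i) F)) = (\<Prod>i=0..<k. if \<pi> i = \<rho> i then 1 else 0)"
      by (intro prod.cong refl) (use lt on in auto)
    also have "\<dots> = (if \<rho> = \<pi> then 1 else 0 :: real)"
    proof (cases "\<rho> = \<pi>")
      case False
      then obtain i where "\<rho> i \<noteq> \<pi> i" by blast
      moreover have "i < k"
        using mem \<open>\<rho> i \<noteq> \<pi> i\<close> by (metis P_def atLeastLessThan_iff mem_Collect_eq permutes_not_in zero_le)
      ultimately show ?thesis using False by (auto intro!: bexI[of _ i] simp: prod_zero_iff)
    qed auto
    also have "signof \<pi> * signof \<rho> * (if \<rho> = \<pi> then 1 else 0 :: real) = (if \<rho> = \<pi> then 1 else 0)"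
      by (auto simp: sign_def)
    finally show "(\<Sum>g\<in>{0..<k} \<rightarrow>\<^sub>E R. signof \<pi> * signof \<rho> * (\<Prod>i=0..<k. p (g i) * (e (\<pi> i) (g i) * e (\<rho> i) (g i))))
       = (if \<rho> = \<pi> then 1 else 0)" .
  qed
  also have "\<dots> = real (card P)" using finP by simp
  also have "card P = fact k" unfolding P_def by (subst card_permutations[of _ k]) auto
  finally show ?thesis by simp
qed

lemma orthonormal_expansion:
  fixes e :: "'i \<Rightarrow> 'a::real_inner"
  assumes I: "finite I"
    and on: "\<And>i j. i \<in> I \<Longrightarrow> j \<in> I \<Longrightarrow> inner (e i) (e j) = (if i = j then 1 else 0)"
    and x: "x \<in> span (e ` I)"
  shows "x = (\<Sum>l\<in>I. inner x (e l) *\<^sub>R e l)"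
proof -
  obtain u where u: "x = (\<Sum>l\<in>I. u l *\<^sub>R e l)"
    using in_span_imageE[OF x I] .
  have "inner x (e i) = u i" if "i \<in> I" for i
  proof -
    have "inner x (e i) = (\<Sum>l\<in>I. if l = i then u i else 0)"
      unfolding u inner_sum_left by (rule sum.cong) (use on that in auto)
    then show ?thesis using that I by simp
  qed
  then show ?thesis using u by simp
qed

text \<open>A single term of the exponential series at \<open>k\<close>, with
  \<open>exp 1 \<le> 3\<close>.\<close>

lemma power_le_fact: "real k ^ k \<le> 3 ^ k * fact k"
proof -
  have "real k ^ k / fact k \<le> exp (real k)"
  proof -
    have "(\<lambda>n. real k ^ n / fact n) sums exp (real k)"
      using exp_converges[of "real k"] by (simp add: divide_inverse mult.commute scaleR_conv_of_real)
    then show ?thesis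
      using sum_le_suminf[of "\<lambda>n. real k ^ n / fact n" "{k}"] by (simp add: sums_iff)
  qed
  also have "exp (real k) = exp 1 ^ k" by (simp flip: exp_of_nat_mult)
  also have "\<dots> \<le> 3 ^ k" by (intro power_mono exp_le) auto
  finally show ?thesis by (simp add: field_simps)
qed

text \<open>Hereditary discrepancy at most \<open>h\<close>, for integer matrices and as existence
  of colourings: the form that passes to submatrices.\<close>

definition hereditary_bound :: "'r set \<Rightarrow> 'c set \<Rightarrow> ('r \<Rightarrow> 'c \<Rightarrow> int) \<Rightarrow> int \<Rightarrow> bool" where
  "hereditary_bound R V A h \<longleftrightarrow> (\<forall>J\<subseteq>V. \<exists>\<xi>. (\<forall>j\<in>J. \<xi> j \<in> {-1, 1}) \<and> (\<forall>F\<in>R. \<bar>\<Sum>j\<in>J. A F j * \<xi> j\<bar> \<le> h))"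

text \<open>In the basis \<open>e\<close> the chosen columns form a triangular matrix
  \<open>T\<close> with diagonal at least \<epsilon>, and the submatrix of \<open>A\<close> on the
  rows \<open>g\<close> is \<open>E * T\<close>, where \<open>E\<close> samples the basis at these
  rows. The weights of all row tuples add up to at most 1, so some \<open>g\<close> brings the
  squared determinant of \<open>E\<close> up to \<open>fact k\<close>.\<close>

lemma exists_rows_large_det:
  fixes A :: "'r \<Rightarrow> 'c \<Rightarrow> int" and p :: "'r \<Rightarrow> real" and e :: "nat \<Rightarrow> 'r fvec" and f :: "nat \<Rightarrow> 'c"
  assumes R: "finite R" and p: "\<And>F. F \<in> R \<Longrightarrow> 0 < p F" "(\<Sum>F\<in>R. p F) \<le> 1"
    and X: "\<And>v. X v = fvec_of R (\<lambda>F. sqrt (p F) * of_int (A F v))"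
    and on: "\<And>i j. i < k \<Longrightarrow> j < k \<Longrightarrow> inner (e i) (e j) = (if i = j then 1 else 0)"
    and supp: "\<And>i F. i < k \<Longrightarrow> F \<notin> R \<Longrightarrow> coord (e i) F = 0"
    and span: "\<And>j. j < k \<Longrightarrow> X (f j) \<in> span (e ` {..<k})"
    and tri: "\<And>j l. j < l \<Longrightarrow> l < k \<Longrightarrow> inner (X (f j)) (e l) = 0"
    and diag: "\<And>j. j < k \<Longrightarrow> \<epsilon> \<le> inner (X (f j)) (e j)" and \<epsilon>: "0 \<le> \<epsilon>"
  shows "\<exists>g. (\<forall>i<k. g i \<in> R) \<and>
    fact k * (\<epsilon> ^ k)\<^sup>2 \<le> (of_int (Determinant.det (Matrix.mat k k (\<lambda>(i, j). A (g i) (f j)))))\<^sup>2"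
proof -
  \<comment> \<open>Division by \<open>sqrt (p F)\<close> removes the weights from the columns
    \<open>X v\<close>, so that unweighted entries of \<open>A\<close> reappear in the
    product.\<close>
  define e' where "e' l F = coord (e l) F / sqrt (p F)" for l F
  have "(\<Sum>F\<in>R. p F * (e' i F * e' j F)) = (if i = j then 1 else 0)" if "i < k" "j < k" for i j
  proof -
    have "(\<Sum>F\<in>R. p F * (e' i F * e' j F)) = (\<Sum>F\<in>R. coord (e i) F * coord (e j) F)"
    proof (intro sum.cong refl)
      fix F assume "F \<in> R"
      then have "sqrt (p F) * sqrt (p F) = p F" "p F > 0" using p by (auto simp: less_imp_le)
      then show "p F * (e' i F * e' j F) = coord (e i) F * coord (e j) F"
        by (simp add: e'_def)
    qed
    also have "\<dots> = inner (e i) (e j)"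
      using R supp[OF that(1)] by (subst inner_fvec_superset[of R]) auto
    finally show ?thesis using on[OF that] by simp
  qed
  from sum_weighted_det_square[OF R this]
  have total: "(\<Sum>g\<in>{0..<k} \<rightarrow>\<^sub>E R. (\<Prod>i=0..<k. p (g i)) * (Determinant.det (Matrix.mat k k (\<lambda>(i, j). e' j (g i))))\<^sup>2) = fact k" .
  have "\<exists>g\<in>{0..<k} \<rightarrow>\<^sub>E R. (Determinant.det (Matrix.mat k k (\<lambda>(i, j). e' j (g i))))\<^sup>2 \<ge> fact k"
  proof (rule ccontr)
    assume "\<not> ?thesis"
    then have lt: "(Determinant.det (Matrix.mat k k (\<lambda>(i, j). e' j (g i))))\<^sup>2 < fact k" if "g \<in> {0..<k} \<rightarrow>\<^sub>E R" for g
      using that by force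
    have pos: "0 < (\<Prod>i=0..<k. p (g i))" if "g \<in> {0..<k} \<rightarrow>\<^sub>E R" for g
      by (intro prod_pos ballI p(1) PiE_mem[OF that])
    have "{0..<k} \<rightarrow>\<^sub>E R \<noteq> {}"
    proof
      assume "{0..<k} \<rightarrow>\<^sub>E R = {}"
      from total[unfolded this] show False by simp
    qed
    then have "(\<Sum>g\<in>{0..<k} \<rightarrow>\<^sub>E R. (\<Prod>i=0..<k. p (g i)) * (Determinant.det (Matrix.mat k k (\<lambda>(i, j). e' j (g i))))\<^sup>2)
        < (\<Sum>g\<in>{0..<k} \<rightarrow>\<^sub>E R. (\<Prod>i=0..<k. p (g i)) * fact k)"
      using R by (intro sum_strict_mono finite_PiE mult_strict_left_mono lt pos) auto
    then have "fact k < (\<Sum>g\<in>{0..<k} \<rightarrow>\<^sub>E R. (\<Prod>i=0..<k. p (g i)) * fact k)"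
      using total by simp
    also have "\<dots> = (\<Sum>F\<in>R. p F) ^ k * fact k"
      using R by (subst sum_distrib_right[symmetric], subst prod_sum_PiE[symmetric]) auto
    also have "\<dots> \<le> 1 * fact k"
      using p by (intro mult_right_mono power_le_one sum_nonneg) (auto simp: less_imp_le)
    finally show False by simp
  qed
  then obtain g where g: "g \<in> {0..<k} \<rightarrow>\<^sub>E R"
    "(Determinant.det (Matrix.mat k k (\<lambda>(i, j). e' j (g i))))\<^sup>2 \<ge> fact k" by blast
  have gR: "g i \<in> R" if "i < k" for i using g(1) that by auto
  define E where "E = Matrix.mat k k (\<lambda>(i, j). e' j (g i))"
  define T where "T = Matrix.mat k k (\<lambda>(l, j). inner (X (f j)) (e l))"
  define M where "M = Matrix.mat k k (\<lambda>(i, j). A (g i) (f j))"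
  have "map_mat real_of_int M = E * T"
  proof (rule eq_matI)
    fix i j assume "i < dim_row (E * T)" "j < dim_col (E * T)"
    then have ij: "i < k" "j < k" by (auto simp: E_def T_def)
    have pp: "p (g i) > 0" using p gR ij by auto
    have "sqrt (p (g i)) * of_int (A (g i) (f j)) = coord (X (f j)) (g i)"
      using gR ij R by (simp add: X coord_fvec_of)
    also have "\<dots> = (\<Sum>l<k. inner (X (f j)) (e l) * coord (e l) (g i))"
      using arg_cong[OF orthonormal_expansion[of "{..<k}" e "X (f j)"], of "\<lambda>x. coord x (g i)"] on span[OF ij(2)]
      by simp
    finally have "of_int (A (g i) (f j)) = (\<Sum>l<k. e' l (g i) * inner (X (f j)) (e l))"
      using pp by (simp add: e'_def sum_divide_distrib[symmetric] field_simps)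
    then show "map_mat real_of_int M $$ (i, j) = (E * T) $$ (i, j)"
      using ij by (simp add: M_def E_def T_def scalar_prod_def atLeast0LessThan)
  qed (auto simp: M_def E_def T_def)
  then have "real_of_int (Determinant.det M) = Determinant.det E * Determinant.det T"
    using det_mult[of E k T] by (simp add: E_def T_def flip: of_int_hom.hom_det)
  moreover have "\<epsilon> ^ k \<le> Determinant.det T"
  proof -
    have "Determinant.det T = prod_list (diag_mat T)"
      by (rule det_upper_triangular[of _ k]) (auto simp: T_def upper_triangular_def tri)
    also have "\<dots> = (\<Prod>j=0..<k. inner (X (f j)) (e j))"
      by (subst prod_list_diag_prod) (simp add: T_def)
    finally have "Determinant.det T = (\<Prod>j=0..<k. inner (X (f j)) (e j))" .
    moreover have "(\<Prod>j=0..<k. \<epsilon>) \<le> (\<Prod>j=0..<k. inner (X (f j)) (e j))"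
      using diag \<epsilon> by (intro prod_mono) auto
    ultimately show ?thesis by simp
  qed
  then have "(\<epsilon> ^ k)\<^sup>2 \<le> (Determinant.det T)\<^sup>2" using \<epsilon> by (intro power_mono) auto
  ultimately have "fact k * (\<epsilon> ^ k)\<^sup>2 \<le> (real_of_int (Determinant.det M))\<^sup>2"
    using g(2) unfolding E_def[symmetric] by (simp add: power_mult_distrib mult_mono)
  then show ?thesis using gR unfolding M_def by blast
qed

lemma exists_low_rank_approximation:
  fixes A :: "'r \<Rightarrow> 'c \<Rightarrow> int" and p :: "'r \<Rightarrow> real" and q :: "'c \<Rightarrow> real"
  assumes R: "finite R" and p: "\<And>F. F \<in> R \<Longrightarrow> 0 < p F" "(\<Sum>F\<in>R. p F) \<le> 1"
    and V: "finite V" and q: "\<And>v. v \<in> V \<Longrightarrow> 0 \<le> q v" "(\<Sum>v\<in>V. q v) \<le> 1"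
    and h: "h \<ge> 1" "hereditary_bound R V A h" and k: "k \<ge> 1"
    and X: "\<And>v. X v = fvec_of R (\<lambda>F. sqrt (p F) * of_int (A F v))"
  shows "\<exists>T\<subseteq>V. card T < k \<and> (\<Sum>v\<in>V. q v * (norm (X v - proj (X ` T) (X v)))\<^sup>2) \<le> 36 * (of_int h)\<^sup>2 / real k"
proof (rule ccontr)
  assume contra: "\<not> ?thesis"
  \<comment> \<open>The greedy columns give a squared determinant of at least
    \<open>fact k * 36 ^ k * h ^ (2 * k) / k ^ k\<close>, hence at least
    \<open>12 ^ k * h ^ (2 * k)\<close>, while colourings allow at most
    \<open>9 ^ k * h ^ (2 * k)\<close>. In \<open>36 = 3 * 12\<close> the 3 stands for Euler's
    number and 12 only has to exceed 9.\<close>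
  define \<epsilon> where "\<epsilon> = 6 * of_int h / sqrt (real k)"
  have \<epsilon>: "\<epsilon> > 0" using h k by (simp add: \<epsilon>_def)
  have \<epsilon>2: "\<epsilon>\<^sup>2 = 36 * (of_int h)\<^sup>2 / real k" using k by (simp add: \<epsilon>_def power_divide power_mult_distrib)
  define res where "res T v = X v - proj (X ` T) (X v)" for T v
  have "\<exists>v\<in>V. \<epsilon> < norm (res T v)" if T: "T \<subseteq> V" "card T < k" for T
  proof (rule ccontr)
    assume "\<not> ?thesis"
    then have "(norm (res T v))\<^sup>2 \<le> \<epsilon>\<^sup>2" if "v \<in> V" for v
      using that by (intro power_mono) force+
    then have "(\<Sum>v\<in>V. q v * (norm (res T v))\<^sup>2) \<le> (\<Sum>v\<in>V. q v * \<epsilon>\<^sup>2)"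
      using q by (intro sum_mono mult_left_mono) auto
    also have "\<dots> \<le> 1 * \<epsilon>\<^sup>2" unfolding sum_distrib_right[symmetric] using q by (intro mult_right_mono) auto
    finally show False using contra T unfolding res_def \<epsilon>2 by auto
  qed
  then obtain sel where sel: "\<And>T. T \<subseteq> V \<Longrightarrow> card T < k \<Longrightarrow> sel T \<in> V \<and> \<epsilon> < norm (res T (sel T))"
    by metis
  \<comment> \<open>\<open>T i\<close> collects the first \<open>i\<close> greedy choices. Only
    \<open>card (T i) \<le> i\<close> is recorded; distinctness follows later from the triangular
    shape.\<close>
  define T where "T = rec_nat {} (\<lambda>_ T. insert (sel T) T)"
  have T0: "T 0 = {}" and TS: "T (Suc i) = insert (sel (T i)) (T i)" for i by (simp_all add: T_def)
  have Tk: "T i \<subseteq> V \<and> card (T i) \<le> i \<and> finite (T i)" if "i \<le> k" for i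
    using that
  proof (induction i)
    case (Suc i)
    then have "sel (T i) \<in> V" using sel[of "T i"] by auto
    then show ?case using Suc by (auto simp: TS card_insert_if)
  qed (simp add: T0)
  define f where "f i = sel (T i)" for i
  define y where "y i = res (T i) (f i)" for i
  define e where "e i = y i /\<^sub>R norm (y i)" for i
  have fV: "f i \<in> V" and ny: "\<epsilon> < norm (y i)" if "i < k" for i
    using sel[of "T i"] Tk[of i] that by (auto simp: f_def y_def)
  have Tmono: "T i \<subseteq> T j" if "i \<le> j" for i j
    by (rule lift_Suc_mono_le[OF _ that]) (auto simp: TS)
  have fT: "f i \<in> T j" if "i < j" for i j
    using Tmono[of "Suc i" j] that by (auto simp: TS f_def)
  have finX: "finite (X ` T i)" if "i < k" for i using Tk[of i] that by auto
  have orthT: "inner (y i) z = 0" if "i < k" "z \<in> span (X ` T i)" for i z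
    unfolding y_def res_def by (rule proj(2)[OF finX[OF that(1)] that(2)])
  have ydec: "X (f i) = y i + proj (X ` T i) (X (f i))" for i by (simp add: y_def res_def)
  have pspan: "proj (X ` T i) (X (f i)) \<in> span (X ` T i)" if "i < k" for i
    by (rule proj(1)[OF finX[OF that]])
  have yspan: "y i \<in> span (X ` T j)" if "i < j" "i < k" for i j
  proof -
    have "span (X ` T i) \<subseteq> span (X ` T j)" using Tmono[of i j] that by (intro span_mono image_mono) auto
    then show ?thesis unfolding y_def res_def
      using fT[OF that(1)] pspan[OF that(2)] by (intro span_diff) (auto intro: span_base)
  qed
  have yy: "inner (y i) (y j) = 0" if "i < k" "j < k" "i \<noteq> j" for i j
    using orthT[of i "y j"] orthT[of j "y i"] yspan[of i j] yspan[of j i] that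
    by (cases "i < j") (auto simp: inner_commute)
  have on: "inner (e i) (e j) = (if i = j then 1 else 0)" if "i < k" "j < k" for i j
  proof -
    have "norm (y i) > 0" "norm (y j) > 0" using ny[OF that(1)] ny[OF that(2)] \<epsilon> by linarith+
    then show ?thesis using yy[OF that]
      by (auto simp: e_def power2_norm_eq_inner[symmetric] power2_eq_square field_simps)
  qed
  have Tspan: "span (X ` T i) \<subseteq> span (e ` {..<i})" if "i \<le> k" for i
    using that
  proof (induction i)
    case (Suc i)
    then have IH: "span (X ` T i) \<subseteq> span (e ` {..<i})" and i: "i < k" by auto
    have mono: "span (e ` {..<i}) \<subseteq> span (e ` {..<Suc i})" by (intro span_mono) auto
    have "norm (y i) > 0" using ny[OF i] \<epsilon> by linarith
    then have "y i = norm (y i) *\<^sub>R e i" by (simp add: e_def)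
    moreover have "norm (y i) *\<^sub>R e i \<in> span (e ` {..<Suc i})" by (intro span_scale span_base) auto
    ultimately have "X (f i) \<in> span (e ` {..<Suc i})"
      using pspan[OF i] IH mono by (subst ydec, intro span_add) auto
    moreover have "X ` T i \<subseteq> span (e ` {..<Suc i})"
      using span_superset[of "X ` T i"] IH mono by blast
    ultimately show ?case by (intro span_minimal) (auto simp: TS f_def)
  qed (simp add: T0)
  have XTk: "X (f j) \<in> span (e ` {..<k})" if "j < k" for j
    using Tspan[of k] fT[OF that] by (meson imageI in_mono order_refl span_base)
  have ySupp: "coord (e i) F = 0" if "i < k" "F \<notin> R" for i F
  proof -
    have "span (X ` T k) \<subseteq> {x. coord x F = 0}"
      by (intro span_minimal) (use R that in \<open>auto simp: X coord_fvec_of subspace_def\<close>)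
    then show ?thesis using yspan[of i k] that by (auto simp: e_def)
  qed
  have Xe: "inner (X (f j)) (e l) = 0" if "j < l" "l < k" for j l
    using orthT[OF that(2), of "X (f j)"] fT[OF that(1)] by (simp add: e_def span_base inner_commute)
  have Xd: "\<epsilon> \<le> inner (X (f j)) (e j)" if "j < k" for j
  proof -
    have "inner (X (f j)) (y j) = inner (y j + proj (X ` T j) (X (f j))) (y j)"
      by (rule arg_cong[OF ydec, of "\<lambda>x. inner x (y j)"])
    also have "\<dots> = inner (y j) (y j)"
      using orthT[OF that pspan[OF that]] by (metis add.right_neutral inner_add_left inner_commute)
    finally have "inner (X (f j)) (e j) = norm (y j)"
      using ny[OF that] \<epsilon> by (simp add: e_def power2_norm_eq_inner[symmetric] power2_eq_square field_simps)
    then show ?thesis using ny[OF that] by simp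
  qed
  \<comment> \<open>Distinct columns allow a colouring of columns in \<open>V\<close> to be pulled
    back to the submatrix.\<close>
  have inj: "inj_on f {..<k}"
  proof (rule linorder_inj_onI)
    fix i j assume ij: "i < j" "j \<in> {..<k}"
    then have "inner (X (f i)) (e j) = 0" using Xe by auto
    moreover have "inner (X (f j)) (e j) > 0" using Xd[of j] ij \<epsilon> by auto
    ultimately show "f i \<noteq> f j" by auto
  qed auto
  obtain g where g: "\<And>i. i < k \<Longrightarrow> g i \<in> R"
    "fact k * (\<epsilon> ^ k)\<^sup>2 \<le> (of_int (Determinant.det (Matrix.mat k k (\<lambda>(i, j). A (g i) (f j)))))\<^sup>2"
  proof -
    have "\<exists>g. (\<forall>i<k. g i \<in> R) \<and>
      fact k * (\<epsilon> ^ k)\<^sup>2 \<le> (of_int (Determinant.det (Matrix.mat k k (\<lambda>(i, j). A (g i) (f j)))))\<^sup>2"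
      by (rule exists_rows_large_det[where p = p and X = X and e = e])
         (fact R p X on ySupp XTk Xe Xd less_imp_le[OF \<epsilon>])+
    then show ?thesis using that by blast
  qed
  define M where "M = Matrix.mat k k (\<lambda>(i, j). A (g i) (f j))"
  have "\<bar>Determinant.det M\<bar> \<le> (2 * h + 1) ^ k"
  proof (rule det_le_of_hereditary_colouring)
    fix J assume J: "J \<subseteq> {..<k}"
    have "f ` J \<subseteq> V" using J fV by auto
    then obtain \<xi> where \<xi>: "\<forall>j\<in>f ` J. \<xi> j \<in> {-1, 1}" "\<And>F. F \<in> R \<Longrightarrow> \<bar>\<Sum>j\<in>f ` J. A F j * \<xi> j\<bar> \<le> h"
      using h(2) unfolding hereditary_bound_def by meson
    have "\<bar>\<Sum>j\<in>J. M $$ (i, j) * \<xi> (f j)\<bar> \<le> h" if i: "i < k" for i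
    proof -
      have "(\<Sum>j\<in>J. M $$ (i, j) * \<xi> (f j)) = (\<Sum>j\<in>J. A (g i) (f j) * \<xi> (f j))"
        by (rule sum.cong) (use J i in \<open>auto simp: M_def\<close>)
      also have "\<dots> = (\<Sum>j\<in>f ` J. A (g i) j * \<xi> j)"
        using inj_on_subset[OF inj J] by (simp add: sum.reindex)
      finally show ?thesis using \<xi>(2)[OF g(1)[OF i]] by simp
    qed
    then show "\<exists>\<xi>. (\<forall>j\<in>J. \<xi> j \<in> {-1, 1}) \<and> (\<forall>i\<in>{..<k}. \<bar>\<Sum>j\<in>J. M $$ (i, j) * \<xi> j\<bar> \<le> h)"
      using \<xi>(1) by (intro exI[of _ "\<lambda>j. \<xi> (f j)"]) auto
  qed (use h in \<open>auto simp: M_def\<close>)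
  also have "\<dots> \<le> (3 * h) ^ k" using h by (intro power_mono) auto
  finally have "real_of_int \<bar>Determinant.det M\<bar> \<le> real_of_int ((3 * h) ^ k)" by (simp only: of_int_le_iff)
  then have "(real_of_int \<bar>Determinant.det M\<bar>)\<^sup>2 \<le> (real_of_int ((3 * h) ^ k))\<^sup>2" by (intro power_mono) auto
  then have "(real_of_int (Determinant.det M))\<^sup>2 \<le> ((3 * of_int h) ^ k)\<^sup>2" by simp
  also have "\<dots> = ((3 * of_int h)\<^sup>2) ^ k" by (simp only: power_mult[symmetric] mult.commute)
  also have "(3 * real_of_int h)\<^sup>2 = 9 * (of_int h)\<^sup>2" by (simp add: power_mult_distrib)
  also have "(9 * (real_of_int h)\<^sup>2) ^ k = 9 ^ k * ((of_int h)\<^sup>2) ^ k" by (rule power_mult_distrib)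
  finally have up: "(real_of_int (Determinant.det M))\<^sup>2 \<le> 9 ^ k * ((of_int h)\<^sup>2) ^ k" .
  have "(\<epsilon> ^ k)\<^sup>2 = (\<epsilon>\<^sup>2) ^ k" by (simp only: power_mult[symmetric] mult.commute)
  also have "\<epsilon>\<^sup>2 = 12 * 3 * (of_int h)\<^sup>2 / real k" unfolding \<epsilon>2 by simp
  also have "(12 * 3 * (of_int h)\<^sup>2 / real k) ^ k = 12 ^ k * 3 ^ k * ((of_int h)\<^sup>2) ^ k / real k ^ k"
    by (simp only: power_divide power_mult_distrib)
  finally have "fact k * (\<epsilon> ^ k)\<^sup>2 = 12 ^ k * ((of_int h)\<^sup>2) ^ k * (3 ^ k * fact k / real k ^ k)" by simp
  moreover have "3 ^ k * fact k / real k ^ k \<ge> 1"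
    using power_le_fact[of k] k by (simp add: field_simps)
  then have "12 ^ k * ((of_int h)\<^sup>2) ^ k * (3 ^ k * fact k / real k ^ k) \<ge> 12 ^ k * ((of_int h)\<^sup>2) ^ k * 1"
    by (intro mult_left_mono) auto
  moreover have "(9::real) ^ k * ((of_int h)\<^sup>2) ^ k < 12 ^ k * ((of_int h)\<^sup>2) ^ k"
    using h k by (intro mult_strict_right_mono power_strict_mono) auto
  ultimately show False using g(2) up unfolding M_def by linarith
qed

section \<open>Minimax\<close>

text \<open>The minimum over \<open>D\<close> of the squared excess over \<open>2 K\<close> cannot be large: at a near-minimiser
  \<open>y\<close>, moving towards a point that is cheap for the weights \<open>max 0 (y - 2 K)\<close> decreases it. Those
  weights are mixed with uniform ones to keep the coordinates of that point bounded.\<close>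
lemma minimax_convex:
  fixes D :: "('i \<Rightarrow> real) set" and K :: real
  assumes I: "finite I" "I \<noteq> {}" and K: "K > 0"
    and nonneg: "\<And>y i. y \<in> D \<Longrightarrow> i \<in> I \<Longrightarrow> 0 \<le> y i"
    and conv: "\<And>y z l. y \<in> D \<Longrightarrow> z \<in> D \<Longrightarrow> 0 \<le> l \<Longrightarrow> l \<le> 1 \<Longrightarrow> (\<lambda>i. (1 - l) * y i + l * z i) \<in> D"
    and cheap: "\<And>w. (\<And>i. i \<in> I \<Longrightarrow> 0 < w i) \<Longrightarrow> (\<Sum>i\<in>I. w i) = 1 \<Longrightarrow> \<exists>z\<in>D. (\<Sum>i\<in>I. w i * z i) \<le> K"
  shows "\<exists>y\<in>D. \<forall>i\<in>I. y i \<le> 3 * K"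
proof (rule ccontr)
  assume contra: "\<not> (\<exists>y\<in>D. \<forall>i\<in>I. y i \<le> 3 * K)"
  define N where "N = real (card I)"
  have N: "N \<ge> 1" using I by (simp add: N_def Suc_le_eq card_gt_0_iff)
  \<comment> \<open>The threshold is \<open>2 * K\<close> because mixing with uniform weights halves
    the weight of the excesses, so a cheap point may cost \<open>2 * K\<close> on them. Failure of
    \<open>3 * K\<close> leaves an excess above \<open>K\<close>, which keeps the penalty away from
    0.\<close>
  define ex where "ex y i = max 0 (y i - 2 * K)" for y :: "'i \<Rightarrow> real" and i
  define \<phi> where "\<phi> y = (\<Sum>i\<in>I. (ex y i)\<^sup>2)" for y
  have \<phi>_ge: "\<phi> y \<ge> K\<^sup>2" if y: "y \<in> D" for y
  proof -
    obtain i where i: "i \<in> I" "y i > 3 * K" using contra y by force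
    have "K\<^sup>2 \<le> (ex y i)\<^sup>2" using i K by (intro power_mono) (auto simp: ex_def)
    also have "\<dots> \<le> \<phi> y" unfolding \<phi>_def using I i by (intro member_le_sum) auto
    finally show ?thesis .
  qed
  have "D \<noteq> {}"
    using cheap[of "\<lambda>_. 1 / N"] N by (auto simp: N_def)
  \<comment> \<open>\<open>D\<close> is not assumed closed, so a near-minimiser has to replace a
    minimiser.\<close>
  define \<delta> where "\<delta> = Inf (\<phi> ` D)"
  have bdd: "bdd_below (\<phi> ` D)" using \<phi>_ge by (intro bdd_belowI[of _ "K\<^sup>2"]) auto
  have \<delta>_le: "\<delta> \<le> \<phi> y" if "y \<in> D" for y unfolding \<delta>_def using that bdd by (intro cInf_lower) auto
  have \<delta>: "\<delta> \<ge> K\<^sup>2" unfolding \<delta>_def using \<open>D \<noteq> {}\<close> \<phi>_ge by (intro cInf_greatest) auto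
  have \<delta>pos: "\<delta> > 0" using \<delta> K zero_less_power[of K 2] by linarith
  define B where "B = 2 * K * N"
  define C where "C = N * B\<^sup>2"
  have C: "C > 0" using K N by (simp add: C_def B_def)
  \<comment> \<open>Step length for which the second-order term \<open>l\<^sup>2 * C\<close> takes
    at most half of the first-order gain \<open>l * \<delta>\<close>; the other half is the allowed
    distance of \<open>\<phi> y\<close> from the infimum.\<close>
  define l where "l = min 1 (\<delta> / (2 * C))"
  have l: "0 < l" "l \<le> 1" "l * C \<le> \<delta> / 2"
    using C \<delta>pos by (auto simp: l_def min_def field_simps)
  have "\<exists>v\<in>\<phi> ` D. v < \<delta> + l * \<delta> / 2"
  proof -
    have "\<delta> < \<delta> + l * \<delta> / 2" using l \<delta>pos by simp
    then show ?thesis unfolding \<delta>_def using \<open>D \<noteq> {}\<close> bdd by (subst (asm) (1) cInf_less_iff) auto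
  qed
  then obtain y where y: "y \<in> D" "\<phi> y < \<delta> + l * \<delta> / 2" by blast
  define W where "W = (\<Sum>i\<in>I. ex y i)"
  have ex0: "ex y i \<ge> 0" for i by (simp add: ex_def)
  have W: "W > 0"
  proof -
    obtain i where i: "i \<in> I" "y i > 3 * K" using contra y by force
    have "0 < ex y i" using i K by (simp add: ex_def)
    also have "\<dots> \<le> W" unfolding W_def using I i ex0 by (intro member_le_sum) auto
    finally show ?thesis .
  qed
  define w where "w i = (ex y i + W / N) / (2 * W)" for i
  have "(\<Sum>i\<in>I. ex y i + W / N) = 2 * W"
    using N by (simp add: sum.distrib W_def[symmetric] N_def[symmetric])
  then have "(\<Sum>i\<in>I. w i) = 1"
    using W by (simp add: w_def sum_divide_distrib[symmetric])
  moreover have "0 < w i" for i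
    using W N ex0[of i] by (simp add: w_def add_nonneg_pos)
  ultimately obtain z where z: "z \<in> D" "(\<Sum>i\<in>I. w i * z i) \<le> K" using cheap by blast
  have z0: "0 \<le> z i" if "i \<in> I" for i using nonneg[OF z(1) that] .
  have "(\<Sum>i\<in>I. w i * z i) = ((\<Sum>i\<in>I. ex y i * z i) + W / N * (\<Sum>i\<in>I. z i)) / (2 * W)"
    by (simp add: w_def sum_divide_distrib sum_distrib_left sum.distrib[symmetric] add_divide_distrib distrib_right)
  then have zsum: "(\<Sum>i\<in>I. ex y i * z i) + W / N * (\<Sum>i\<in>I. z i) \<le> 2 * K * W"
    using z(2) W by (simp add: pos_divide_le_eq mult_ac)
  have 1: "(\<Sum>i\<in>I. ex y i * z i) \<le> 2 * K * W"
  proof -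
    have "W / N * (\<Sum>i\<in>I. z i) \<ge> 0" using W N z0 by (intro mult_nonneg_nonneg sum_nonneg) auto
    then show ?thesis using zsum by linarith
  qed
  have zB: "z i \<le> B" if i: "i \<in> I" for i
  proof -
    have "(\<Sum>i\<in>I. ex y i * z i) \<ge> 0" using ex0 z0 by (intro sum_nonneg mult_nonneg_nonneg) auto
    then have "W / N * (\<Sum>i\<in>I. z i) \<le> 2 * K * W" using zsum by linarith
    then have "(\<Sum>i\<in>I. z i) \<le> 2 * K * N" using W N by (simp add: field_simps)
    moreover have "z i \<le> (\<Sum>i\<in>I. z i)" using I i z0 by (intro member_le_sum) auto
    ultimately show ?thesis by (simp add: B_def)
  qed
  define y' where "y' i = (1 - l) * y i + l * z i" for i
  have "y' \<in> D" unfolding y'_def using conv[OF y(1) z(1)] l by simp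
  have "(ex y' i)\<^sup>2 \<le> (1 - l)\<^sup>2 * (ex y i)\<^sup>2 + 2 * l * (1 - l) * (ex y i * (z i - 2 * K)) + l\<^sup>2 * B\<^sup>2"
    if i: "i \<in> I" for i
  proof -
    define s where "s = (1 - l) * ex y i + l * (z i - 2 * K)"
    have "(1 - l) * (y i - 2 * K) \<le> (1 - l) * ex y i"
      using l by (intro mult_left_mono) (auto simp: ex_def)
    then have "y' i - 2 * K \<le> s" by (simp add: s_def y'_def algebra_simps)
    then have "ex y' i \<le> \<bar>s\<bar>" by (auto simp: ex_def)
    then have "(ex y' i)\<^sup>2 \<le> s\<^sup>2" by (metis abs_le_square_iff abs_of_nonneg ex_def max.cobounded1)
    also have "s\<^sup>2 = (1 - l)\<^sup>2 * (ex y i)\<^sup>2 + 2 * l * (1 - l) * (ex y i * (z i - 2 * K)) + l\<^sup>2 * (z i - 2 * K)\<^sup>2"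
      by (simp add: s_def power2_eq_square algebra_simps)
    also have "\<dots> \<le> (1 - l)\<^sup>2 * (ex y i)\<^sup>2 + 2 * l * (1 - l) * (ex y i * (z i - 2 * K)) + l\<^sup>2 * B\<^sup>2"
    proof -
      have "2 * K * 1 \<le> B" unfolding B_def using K N by (intro mult_left_mono) auto
      then have "\<bar>z i - 2 * K\<bar> \<le> \<bar>B\<bar>" using z0[OF i] zB[OF i] K by linarith
      then show ?thesis by (intro add_left_mono mult_left_mono) (auto simp: abs_le_square_iff)
    qed
    finally show ?thesis .
  qed
  then have "\<phi> y' \<le> (\<Sum>i\<in>I. (1 - l)\<^sup>2 * (ex y i)\<^sup>2 + 2 * l * (1 - l) * (ex y i * (z i - 2 * K)) + l\<^sup>2 * B\<^sup>2)"
    unfolding \<phi>_def by (intro sum_mono) auto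
  also have "\<dots> = (1 - l)\<^sup>2 * \<phi> y + 2 * l * (1 - l) * ((\<Sum>i\<in>I. ex y i * z i) - 2 * K * W) + l\<^sup>2 * C"
    by (simp add: sum.distrib \<phi>_def sum_distrib_left W_def C_def N_def right_diff_distrib sum_subtractf mult_ac)
  also have "\<dots> \<le> (1 - l) * \<phi> y + l\<^sup>2 * C"
  proof -
    have "2 * l * (1 - l) * ((\<Sum>i\<in>I. ex y i * z i) - 2 * K * W) \<le> 0"
      using l 1 by (intro mult_nonneg_nonpos) auto
    moreover have "(1 - l)\<^sup>2 * \<phi> y \<le> (1 - l) * \<phi> y"
      using l by (intro mult_right_mono) (auto simp: power2_eq_square \<phi>_def sum_nonneg mult_left_le)
    ultimately show ?thesis by linarith
  qed
  also have "\<dots> < \<delta>"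
  proof (cases "l = 1")
    case True
    then show ?thesis using l \<delta>pos by simp
  next
    case False
    have "(1 - l) * \<phi> y < (1 - l) * (\<delta> + l * \<delta> / 2)" using False l y by simp
    moreover have "l\<^sup>2 * C \<le> l * (\<delta> / 2)" using l by (simp add: power2_eq_square mult.assoc)
    moreover have "(1 - l) * (\<delta> + l * \<delta> / 2) + l * (\<delta> / 2) = \<delta> - l\<^sup>2 * \<delta> / 2"
      by (simp add: power2_eq_square field_simps)
    moreover have "l\<^sup>2 * \<delta> / 2 \<ge> 0" using \<delta>pos by simp
    ultimately show ?thesis by linarith
  qed
  finally show False using \<delta>_le[OF \<open>y' \<in> D\<close>] by simp
qed

section \<open>Factorisations\<close>

text \<open>Squared row and column lengths are recorded exactly and as functions, so that the
  attainable pairs \<open>(x, y)\<close> form a convex set, as minimax requires. The inner dimension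
  \<open>N\<close> varies since factorisations are added by concatenation.\<close>

definition factorisation ::
  "'r set \<Rightarrow> 'c set \<Rightarrow> ('r \<Rightarrow> 'c \<Rightarrow> real) \<Rightarrow> ('r \<Rightarrow> real) \<Rightarrow> ('c \<Rightarrow> real) \<Rightarrow>
    nat \<Rightarrow> ('r \<Rightarrow> nat \<Rightarrow> real) \<Rightarrow> ('c \<Rightarrow> nat \<Rightarrow> real) \<Rightarrow> bool" where
  "factorisation R V M x y N U W \<longleftrightarrow> (\<forall>F\<in>R. \<forall>v\<in>V. M F v = (\<Sum>a<N. U F a * W v a)) \<and>
     (\<forall>F\<in>R. x F = (\<Sum>a<N. (U F a)\<^sup>2)) \<and> (\<forall>v\<in>V. y v = (\<Sum>a<N. (W v a)\<^sup>2))"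

definition factors :: "'r set \<Rightarrow> 'c set \<Rightarrow> ('r \<Rightarrow> 'c \<Rightarrow> real) \<Rightarrow> ('r \<Rightarrow> real) \<Rightarrow> ('c \<Rightarrow> real) \<Rightarrow> bool" where
  "factors R V M x y \<longleftrightarrow> (\<exists>N U W. factorisation R V M x y N U W)"

lemma factorsI: "factorisation R V M x y N U W \<Longrightarrow> factors R V M x y"
  unfolding factors_def by blast

lemma factors_cong:
  assumes "factors R V M x y" "\<And>F v. F \<in> R \<Longrightarrow> v \<in> V \<Longrightarrow> M F v = M' F v"
    "\<And>F. F \<in> R \<Longrightarrow> x F = x' F" "\<And>v. v \<in> V \<Longrightarrow> y v = y' v"
  shows "factors R V M' x' y'"
proof -
  obtain N U W where 1: "factorisation R V M x y N U W"
    using assms(1) unfolding factors_def by blast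
  show ?thesis by (rule factorsI[of _ _ _ _ _ N U W]) (use 1 assms(2-4) in \<open>auto simp: factorisation_def\<close>)
qed

lemma factors_nonneg:
  assumes "factors R V M x y"
  shows "F \<in> R \<Longrightarrow> 0 \<le> x F" "v \<in> V \<Longrightarrow> 0 \<le> y v"
  using assms by (auto simp: factors_def factorisation_def sum_nonneg)

lemma factors_zero: "factors R V (\<lambda>_ _. 0) (\<lambda>_. 0) (\<lambda>_. 0)"
  by (rule factorsI[where N = 0]) (simp add: factorisation_def)

lemma sum_lessThan_add:
  fixes f :: "nat \<Rightarrow> 'b::comm_monoid_add"
  shows "(\<Sum>a<m + n. f a) = (\<Sum>a<m. f a) + (\<Sum>a<n. f (m + a))"
  by (induction n) (auto simp: add.assoc)

lemma factors_add:
  assumes "factors R V M x y" "factors R V M' x' y'"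
  shows "factors R V (\<lambda>F v. M F v + M' F v) (\<lambda>F. x F + x' F) (\<lambda>v. y v + y' v)"
proof -
  obtain N U W where 1: "factorisation R V M x y N U W"
    using assms(1) unfolding factors_def by blast
  obtain N' U' W' where 2: "factorisation R V M' x' y' N' U' W'"
    using assms(2) unfolding factors_def by blast
  show ?thesis
    by (rule factorsI[where N = "N + N'" and U = "\<lambda>F a. if a < N then U F a else U' F (a - N)"
          and W = "\<lambda>v a. if a < N then W v a else W' v (a - N)"])
       (use 1 2 in \<open>simp add: factorisation_def sum_lessThan_add\<close>)
qed

lemma factors_sum:
  assumes "finite T" "\<And>i. i \<in> T \<Longrightarrow> factors R V (M i) (x i) (y i)"
  shows "factors R V (\<lambda>F v. \<Sum>i\<in>T. M i F v) (\<lambda>F. \<Sum>i\<in>T. x i F) (\<lambda>v. \<Sum>i\<in>T. y i v)"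
  using assms
proof (induction T rule: finite_induct)
  case empty
  then show ?case by (simp add: factors_zero)
next
  case (insert i T)
  then show ?case using factors_add[of R V "M i" "x i" "y i"] by simp
qed

lemma factors_scale:
  assumes "factors R V M x y" "0 \<le> c"
  shows "factors R V (\<lambda>F v. c * M F v) (\<lambda>F. c * x F) (\<lambda>v. c * y v)"
proof -
  obtain N U W where 1: "factorisation R V M x y N U W"
    using assms(1) unfolding factors_def by blast
  have c: "sqrt c * z * (sqrt c * z') = c * (z * z')" for z z'
  proof -
    have "sqrt c * z * (sqrt c * z') = (sqrt c * sqrt c) * (z * z')" by (simp add: mult_ac)
    then show ?thesis using assms(2) by simp
  qed
  show ?thesis
    by (rule factorsI[where N = N and U = "\<lambda>F a. sqrt c * U F a" and W = "\<lambda>v a. sqrt c * W v a"])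
       (use 1 assms(2) in \<open>simp add: factorisation_def c power_mult_distrib sum_distrib_left\<close>)
qed

text \<open>Carries a factorisation from \<open>Fs i\<close> over to \<open>FF\<close>, with
  \<open>g\<close> sending a set to its part in \<open>Fs i\<close>; several sets may share a
  part.\<close>

lemma factors_reindex_rows:
  assumes "factors R V M x y" "\<And>F. F \<in> R' \<Longrightarrow> g F \<in> R"
  shows "factors R' V (\<lambda>F. M (g F)) (\<lambda>F. x (g F)) y"
proof -
  obtain N U W where 1: "factorisation R V M x y N U W"
    using assms(1) unfolding factors_def by blast
  show ?thesis
    by (rule factorsI[where N = N and U = "\<lambda>F. U (g F)" and W = W]) (use 1 assms(2) in \<open>auto simp: factorisation_def\<close>)
qed

lemma factors_finite:
  assumes "finite E" "\<And>F v. F \<in> R \<Longrightarrow> v \<in> V \<Longrightarrow> M F v = (\<Sum>e\<in>E. U F e * W v e)"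
  shows "factors R V M (\<lambda>F. \<Sum>e\<in>E. (U F e)\<^sup>2) (\<lambda>v. \<Sum>e\<in>E. (W v e)\<^sup>2)"
proof -
  obtain b where b: "bij_betw b {..<card E} E"
    using ex_bij_betw_nat_finite[OF assms(1)] by (auto simp: atLeast0LessThan)
  have s: "(\<Sum>e\<in>E. f e) = (\<Sum>a<card E. f (b a))" for f :: "_ \<Rightarrow> real"
    using sum.reindex_bij_betw[OF b, of f] by simp
  show ?thesis
    by (rule factorsI[where N = "card E" and U = "\<lambda>F a. U F (b a)" and W = "\<lambda>v a. W v (b a)"])
       (use assms(2) s in \<open>auto simp: factorisation_def\<close>)
qed

lemma sum_coord_square_le:
  assumes "finite R"
  shows "(\<Sum>F\<in>R. (coord x F)\<^sup>2) \<le> (norm x)\<^sup>2"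
proof -
  have "(norm x)\<^sup>2 = (\<Sum>F\<in>R \<union> {i. coord x i \<noteq> 0}. (coord x F)\<^sup>2)"
    unfolding power2_norm_eq_inner using assms finite_coord[of x]
    by (subst inner_fvec_superset[of "R \<union> {i. coord x i \<noteq> 0}"]) (auto simp: power2_eq_square)
  also have "\<dots> \<ge> (\<Sum>F\<in>R. (coord x F)\<^sup>2)"
    using assms finite_coord[of x] by (intro sum_mono2) auto
  finally show ?thesis .
qed

text \<open>Expansion in an orthonormal basis of the span. In the row cost \<open>p F\<close>
  cancels the division by \<open>sqrt (p F)\<close>, so each basis vector costs at most \<tau>; the
  columns cost their mean square length divided by \<tau>. Thus \<tau> trades rank against
  length.\<close>

lemma factors_low_rank:
  fixes D :: "'c \<Rightarrow> 'r fvec" and p :: "'r \<Rightarrow> real" and q :: "'c \<Rightarrow> real"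
  assumes R: "finite R" and p: "\<And>F. F \<in> R \<Longrightarrow> 0 < p F" and B: "finite B"
    and D: "\<And>v. v \<in> V \<Longrightarrow> D v \<in> span B" and \<tau>: "\<tau> > 0"
  shows "\<exists>x y. factors R V (\<lambda>F v. coord (D v) F / sqrt (p F)) x y \<and>
    (\<Sum>F\<in>R. p F * x F) + (\<Sum>v\<in>V. q v * y v) \<le> \<tau> * real (card B) + (\<Sum>v\<in>V. q v * (norm (D v))\<^sup>2) / \<tau>"
proof -
  obtain E where E: "finite E" "card E \<le> card B" "span E = span B"
    "\<forall>e\<in>E. norm e = 1" "pairwise orthogonal E"
    using orthonormalise[OF B] by (elim exE conjE) (rule that)
  have on: "inner e f = (if e = f then 1 else 0)" if "e \<in> E" "f \<in> E" for e f
    using E(4,5) that by (auto simp: norm_eq_1 pairwise_def orthogonal_def)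
  have ex: "D v = (\<Sum>e\<in>E. inner (D v) e *\<^sub>R e)" if "v \<in> V" for v
    using orthonormal_expansion[of E "\<lambda>e. e" "D v"] E(1,3) on D[OF that] by simp
  define U where "U F e = sqrt \<tau> * (coord e F / sqrt (p F))" for F and e :: "'r fvec"
  define W where "W v e = inner (D v) e / sqrt \<tau>" for v e
  have "coord (D v) F / sqrt (p F) = (\<Sum>e\<in>E. U F e * W v e)" if "F \<in> R" "v \<in> V" for F v
    using arg_cong[OF ex[OF that(2)], of "\<lambda>x. coord x F / sqrt (p F)"] \<tau>
    by (simp add: U_def W_def sum_divide_distrib mult_ac)
  from factors_finite[OF E(1) this]
  have "factors R V (\<lambda>F v. coord (D v) F / sqrt (p F)) (\<lambda>F. \<Sum>e\<in>E. (U F e)\<^sup>2) (\<lambda>v. \<Sum>e\<in>E. (W v e)\<^sup>2)" .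
  moreover have "(\<Sum>F\<in>R. p F * (\<Sum>e\<in>E. (U F e)\<^sup>2)) \<le> \<tau> * real (card B)"
  proof -
    have "(\<Sum>F\<in>R. p F * (\<Sum>e\<in>E. (U F e)\<^sup>2)) = (\<Sum>F\<in>R. \<Sum>e\<in>E. \<tau> * (coord e F)\<^sup>2)"
      unfolding sum_distrib_left
    proof (intro sum.cong refl)
      fix F e assume "F \<in> R"
      then show "p F * (U F e)\<^sup>2 = \<tau> * (coord e F)\<^sup>2"
        using p[of F] \<tau> by (simp add: U_def power_mult_distrib power_divide)
    qed
    also have "\<dots> = (\<Sum>e\<in>E. \<tau> * (\<Sum>F\<in>R. (coord e F)\<^sup>2))"
      by (subst sum.swap) (simp add: sum_distrib_left)
    also have "\<dots> \<le> (\<Sum>e\<in>E. \<tau> * 1)"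
      using sum_coord_square_le[OF R] E(4) \<tau> by (intro sum_mono mult_left_mono) (metis one_power2, auto)
    also have "\<dots> \<le> \<tau> * real (card B)" using E(2) \<tau> by simp
    finally show ?thesis .
  qed
  moreover have "(\<Sum>v\<in>V. q v * (\<Sum>e\<in>E. (W v e)\<^sup>2)) = (\<Sum>v\<in>V. q v * (norm (D v))\<^sup>2) / \<tau>"
  proof -
    have "(\<Sum>e\<in>E. (W v e)\<^sup>2) = (norm (D v))\<^sup>2 / \<tau>" if "v \<in> V" for v
    proof -
      have "(norm (D v))\<^sup>2 = inner (D v) (\<Sum>e\<in>E. inner (D v) e *\<^sub>R e)"
        using ex[OF that] by (simp add: power2_norm_eq_inner)
      then have "(norm (D v))\<^sup>2 = (\<Sum>e\<in>E. (inner (D v) e)\<^sup>2)"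
        by (simp add: inner_sum_right power2_eq_square)
      then show ?thesis using \<tau> by (simp add: W_def power_divide sum_divide_distrib)
    qed
    then show ?thesis by (simp add: sum_divide_distrib)
  qed
  ultimately show ?thesis by (intro exI conjI) (assumption, linarith)
qed

lemma weighted_factorisation:
  fixes A :: "'r \<Rightarrow> 'c \<Rightarrow> int" and p :: "'r \<Rightarrow> real" and q :: "'c \<Rightarrow> real"
  assumes R: "finite R" and p: "\<And>F. F \<in> R \<Longrightarrow> 0 < p F" "(\<Sum>F\<in>R. p F) \<le> 1"
    and V: "finite V" and q: "\<And>v. v \<in> V \<Longrightarrow> 0 \<le> q v" "(\<Sum>v\<in>V. q v) \<le> 1"
    and h: "h \<ge> 1" "hereditary_bound R V A h" and L: "card R \<le> 2 ^ L"
  shows "\<exists>x y. factors R V (\<lambda>F v. of_int (A F v)) x y \<and>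
    (\<Sum>F\<in>R. p F * x F) + (\<Sum>v\<in>V. q v * y v) \<le> 36 * of_int h * (real L + 1)"
proof -
  define H where "H = real_of_int h"
  have H: "H \<ge> 1" using h by (simp add: H_def)
  define X where "X v = fvec_of R (\<lambda>F. sqrt (p F) * of_int (A F v))" for v
  have "\<forall>l. \<exists>T. T \<subseteq> V \<and> card T < 2 ^ l \<and>
      (\<Sum>v\<in>V. q v * (norm (X v - proj (X ` T) (X v)))\<^sup>2) \<le> 36 * H\<^sup>2 / 2 ^ l"
  proof
    fix l :: nat
    have "\<exists>T\<subseteq>V. card T < 2 ^ l \<and>
        (\<Sum>v\<in>V. q v * (norm (X v - proj (X ` T) (X v)))\<^sup>2) \<le> 36 * (of_int h)\<^sup>2 / real (2 ^ l)"
      by (rule exists_low_rank_approximation[OF R p V q h _ X_def]) simp_all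
    then show "\<exists>T. T \<subseteq> V \<and> card T < 2 ^ l \<and>
        (\<Sum>v\<in>V. q v * (norm (X v - proj (X ` T) (X v)))\<^sup>2) \<le> 36 * H\<^sup>2 / 2 ^ l"
      by (simp add: H_def)
  qed
  from choice[OF this] obtain T where "\<forall>l. T l \<subseteq> V \<and> card (T l) < 2 ^ l \<and>
      (\<Sum>v\<in>V. q v * (norm (X v - proj (X ` T l) (X v)))\<^sup>2) \<le> 36 * H\<^sup>2 / 2 ^ l" ..
  then have T: "T l \<subseteq> V" "card (T l) < 2 ^ l"
    "(\<Sum>v\<in>V. q v * (norm (X v - proj (X ` T l) (X v)))\<^sup>2) \<le> 36 * H\<^sup>2 / 2 ^ l" for l
    by auto
  have finT: "finite (T l)" for l using T(1) V finite_subset by blast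
  have finXT: "finite (X ` T l)" for l using finT by simp
  define P where "P l v = proj (X ` T l) (X v)" for l v
  define cost where "cost x y = (\<Sum>F\<in>R. p F * x F) + (\<Sum>v\<in>V. q v * y v)" for x y
  have cost_add: "cost (\<lambda>F. x F + x' F) (\<lambda>v. y v + y' v) = cost x y + cost x' y'" for x x' y y'
    by (simp add: cost_def distrib_left sum.distrib)
  have "\<exists>x y. factors R V (\<lambda>F v. coord (P n v) F / sqrt (p F)) x y \<and> cost x y \<le> 36 * H * real n" for n
  proof (induction n)
    case 0
    \<comment> \<open>Fewer than \<open>2 ^ 0\<close> columns means none, so the telescoping sum
      starts at 0.\<close>
    have "T 0 = {}" using T(2)[of 0] finT[of 0] by simp
    then have "P 0 v = 0" for v using proj(1)[OF finXT[of 0], of "X v"] by (simp add: P_def)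
    then show ?case
      by (intro exI[of _ "\<lambda>_. 0"] conjI factors_cong[OF factors_zero]) (auto simp: cost_def)
  next
    case (Suc n)
    then obtain x y where xy: "factors R V (\<lambda>F v. coord (P n v) F / sqrt (p F)) x y" "cost x y \<le> 36 * H * real n"
      by blast
    define D where "D v = P (Suc n) v - P n v" for v
    define B where "B = X ` T n \<union> X ` T (Suc n)"
    have B: "finite B" "real (card B) \<le> 3 * 2 ^ n"
    proof -
      show "finite B" using finXT by (simp add: B_def)
      have "card B \<le> card (T n) + card (T (Suc n))"
        unfolding B_def using card_image_le[OF finT, of X n] card_image_le[OF finT, of X "Suc n"]
        by (intro order_trans[OF card_Un_le]) linarith
      also have "\<dots> \<le> 3 * 2 ^ n" using T(2)[of n] T(2)[of "Suc n"] by simp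
      finally have "real (card B) \<le> real (3 * 2 ^ n)" by (rule of_nat_mono)
      then show "real (card B) \<le> 3 * 2 ^ n" by simp
    qed
    have DB: "D v \<in> span B" for v
    proof -
      have "span (X ` T n) \<subseteq> span B" "span (X ` T (Suc n)) \<subseteq> span B"
        by (auto simp: B_def intro!: span_mono)
      then show ?thesis unfolding D_def P_def using proj(1)[OF finXT] by (intro span_diff) blast+
    qed
    have "(\<Sum>v\<in>V. q v * (norm (D v))\<^sup>2) \<le>
        (\<Sum>v\<in>V. 2 * (q v * (norm (X v - P n v))\<^sup>2) + 2 * (q v * (norm (X v - P (Suc n) v))\<^sup>2))"
    proof (intro sum_mono)
      fix v assume "v \<in> V"
      have "norm (D v) \<le> norm (X v - P n v) + norm (X v - P (Suc n) v)"
        unfolding D_def by (rule order_trans[OF _ norm_triangle_ineq4]) simp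
      then have "(norm (D v))\<^sup>2 \<le> (norm (X v - P n v) + norm (X v - P (Suc n) v))\<^sup>2"
        by (intro power_mono) auto
      also have "\<dots> \<le> 2 * (norm (X v - P n v))\<^sup>2 + 2 * (norm (X v - P (Suc n) v))\<^sup>2"
        using zero_le_power2[of "norm (X v - P n v) - norm (X v - P (Suc n) v)"]
        by (simp add: power2_sum power2_diff)
      finally show "q v * (norm (D v))\<^sup>2 \<le> 2 * (q v * (norm (X v - P n v))\<^sup>2) + 2 * (q v * (norm (X v - P (Suc n) v))\<^sup>2)"
        using mult_left_mono[OF _ q(1)[OF \<open>v \<in> V\<close>]] by (fastforce simp: algebra_simps)
    qed
    also have "\<dots> \<le> 2 * (36 * H\<^sup>2 / 2 ^ n) + 2 * (36 * H\<^sup>2 / 2 ^ Suc n)"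
      unfolding sum.distrib sum_distrib_left[symmetric] P_def using T(3)[of n] T(3)[of "Suc n"]
      by (intro add_mono mult_left_mono) auto
    also have "\<dots> = 108 * H\<^sup>2 / 2 ^ n" by (simp add: field_simps)
    finally have DF: "(\<Sum>v\<in>V. q v * (norm (D v))\<^sup>2) \<le> 108 * H\<^sup>2 / 2 ^ n" .
    \<comment> \<open>Balances the costs: rank \<open>3 * 2 ^ n\<close> and mean square
      \<open>108 * H\<^sup>2 / 2 ^ n\<close> contribute \<open>18 * H\<close> each. The powers of 2
      cancel, so all scales cost the same.\<close>
    define \<tau> where "\<tau> = 6 * H / 2 ^ n"
    have \<tau>: "\<tau> > 0" using H by (simp add: \<tau>_def)
    obtain x' y' where xy': "factors R V (\<lambda>F v. coord (D v) F / sqrt (p F)) x' y'"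
      "cost x' y' \<le> \<tau> * real (card B) + (\<Sum>v\<in>V. q v * (norm (D v))\<^sup>2) / \<tau>"
      using factors_low_rank[where D = D and q = q and V = V and p = p, OF R p(1) B(1) DB \<tau>] unfolding cost_def by blast
    have "\<tau> * real (card B) + (\<Sum>v\<in>V. q v * (norm (D v))\<^sup>2) / \<tau> \<le> \<tau> * (3 * 2 ^ n) + (108 * H\<^sup>2 / 2 ^ n) / \<tau>"
      using B(2) DF \<tau> by (intro add_mono mult_left_mono divide_right_mono) auto
    also have "\<dots> = 36 * H" using H by (simp add: \<tau>_def field_simps power2_eq_square)
    finally have "cost x' y' \<le> 36 * H" using xy'(2) by simp
    moreover have "factors R V (\<lambda>F v. coord (P (Suc n) v) F / sqrt (p F)) (\<lambda>F. x F + x' F) (\<lambda>v. y v + y' v)"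
      by (rule factors_cong[OF factors_add[OF xy(1) xy'(1)]]) (auto simp: D_def diff_divide_distrib)
    ultimately show ?case using xy(2)
      by (intro exI[of _ "\<lambda>F. x F + x' F"] exI[of _ "\<lambda>v. y v + y' v"]) (auto simp: cost_add algebra_simps)
  qed
  then obtain x y where xy: "factors R V (\<lambda>F v. coord (P L v) F / sqrt (p F)) x y" "cost x y \<le> 36 * H * real L"
    by blast
  \<comment> \<open>The last residual has no better rank bound than \<open>card R\<close>, but
    \<open>2 ^ L\<close> dominates this, so it costs no more than another scale: the
    \<open>+ 1\<close> in \<open>real L + 1\<close>.\<close>
  define D where "D v = X v - P L v" for v
  define b where "b F = fvec_of R (\<lambda>G. if G = F then 1 else 0)" for F
  have XB: "X v \<in> span (b ` R)" for v
  proof -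
    have "X v = (\<Sum>F\<in>R. (sqrt (p F) * of_int (A F v)) *\<^sub>R b F)"
      using R by (intro fvec_eqI)
        (auto simp: X_def b_def coord_fvec_of if_distrib[of "\<lambda>c. _ * c"] cong: if_cong)
    then show ?thesis by (simp add: span_sum span_scale span_base)
  qed
  have DB: "D v \<in> span (b ` R)" for v
  proof -
    have "span (X ` T L) \<subseteq> span (b ` R)" using XB by (intro span_minimal) auto
    then show ?thesis unfolding D_def P_def using proj(1)[OF finXT] XB by (intro span_diff) blast+
  qed
  define \<tau> where "\<tau> = 6 * H / 2 ^ L"
  have \<tau>: "\<tau> > 0" using H by (simp add: \<tau>_def)
  have finb: "finite (b ` R)" using R by simp
  obtain x' y' where xy': "factors R V (\<lambda>F v. coord (D v) F / sqrt (p F)) x' y'"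
    "cost x' y' \<le> \<tau> * real (card (b ` R)) + (\<Sum>v\<in>V. q v * (norm (D v))\<^sup>2) / \<tau>"
    using factors_low_rank[where D = D and q = q and V = V and p = p, OF R p(1) finb DB \<tau>] unfolding cost_def by blast
  have "real (card (b ` R)) \<le> 2 ^ L"
    using card_image_le[OF R, of b] L by (metis le_trans numeral_power_le_of_nat_cancel_iff of_nat_le_numeral_power_cancel_iff)
  then have "\<tau> * real (card (b ` R)) + (\<Sum>v\<in>V. q v * (norm (D v))\<^sup>2) / \<tau> \<le> \<tau> * 2 ^ L + (36 * H\<^sup>2 / 2 ^ L) / \<tau>"
    using T(3)[of L] \<tau> by (intro add_mono mult_left_mono divide_right_mono) (auto simp: D_def P_def)
  also have "\<dots> = 12 * H" using H by (simp add: \<tau>_def field_simps power2_eq_square)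
  finally have "cost x' y' \<le> 36 * H" using xy'(2) H by simp
  moreover have "factors R V (\<lambda>F v. of_int (A F v)) (\<lambda>F. x F + x' F) (\<lambda>v. y v + y' v)"
  proof (rule factors_cong[OF factors_add[OF xy(1) xy'(1)]])
    fix F v assume "F \<in> R" "v \<in> V"
    then show "coord (P L v) F / sqrt (p F) + coord (D v) F / sqrt (p F) = of_int (A F v)"
      using p(1)[of F] R by (simp add: D_def X_def coord_fvec_of diff_divide_distrib)
  qed auto
  ultimately show ?thesis using xy(2) unfolding H_def[symmetric] cost_def[symmetric]
    by (intro exI[of _ "\<lambda>F. x F + x' F"] exI[of _ "\<lambda>v. y v + y' v"]) (auto simp: cost_add algebra_simps)
qed

theorem factorisation_of_hereditary_bound:
  fixes A :: "'r \<Rightarrow> 'c \<Rightarrow> int"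
  assumes R: "finite R" "card R \<ge> 2" and V: "finite V"
    and h: "h \<ge> 1" "hereditary_bound R V A h"
  shows "\<exists>x y. factors R V (\<lambda>F v. of_int (A F v)) x y \<and>
    (\<forall>F\<in>R. x F \<le> 486 * (ln (real (card R)) * of_int h)) \<and> (\<forall>v\<in>V. y v \<le> 486 * (ln (real (card R)) * of_int h))"
proof -
  define m where "m = real (card R)"
  define L where "L = nat \<lceil>log 2 m\<rceil>"
  have m: "m \<ge> 2" using R by (simp add: m_def)
  have lg: "log 2 m \<ge> 1" using m by simp
  have L: "card R \<le> 2 ^ L"
  proof -
    have "m = 2 powr log 2 m" using m by simp
    also have "\<dots> \<le> 2 powr real L" unfolding L_def by (intro powr_mono) linarith+
    also have "\<dots> = 2 ^ L" by (simp add: powr_realpow)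
    finally have "real (card R) \<le> real (2 ^ L)" by (simp add: m_def)
    then show ?thesis by (simp only: of_nat_le_iff)
  qed
  have Lle: "real L + 1 \<le> 9 / 2 * ln m"
  proof -
    have "real L + 1 \<le> 3 * log 2 m" using lg unfolding L_def by linarith
    also have "\<dots> \<le> 9 / 2 * ln m"
      using ln2_ge_two_thirds m by (simp add: log_def field_simps)
    finally show ?thesis .
  qed
  \<comment> \<open>\<open>162 = 36 * 9 / 2\<close>, where \<open>9 / 2\<close> is 3 for passing
    from \<open>L + 1\<close> to \<open>log 2 m\<close>, times 3/2 for
    \<open>1 / ln 2\<close>.\<close>
  define K where "K = 162 * (ln m * of_int h)"
  have K: "K > 0" using m h by (simp add: K_def)
  \<comment> \<open>Row and column lengths are bounded in one game, so the weights add up to 1 over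
    both together and to at most 1 over each.\<close>
  define I where "I = Inl ` R \<union> Inr ` V"
  define D where "D = {case_sum x y | x y. factors R V (\<lambda>F v. of_int (A F v)) x y}"
  have "\<exists>z\<in>D. \<forall>i\<in>I. z i \<le> 3 * K"
  proof (rule minimax_convex)
    show "finite I" "I \<noteq> {}" using R V by (auto simp: I_def)
    show "K > 0" by (rule K)
    show "0 \<le> z i" if "z \<in> D" "i \<in> I" for z i
      using that by (auto simp: D_def I_def factors_nonneg)
    show "(\<lambda>i. (1 - l) * z i + l * z' i) \<in> D" if z: "z \<in> D" "z' \<in> D" and l: "0 \<le> l" "l \<le> 1" for z z' l
    proof -
      obtain x y x' y' where xy: "z = case_sum x y" "factors R V (\<lambda>F v. of_int (A F v)) x y"
        "z' = case_sum x' y'" "factors R V (\<lambda>F v. of_int (A F v)) x' y'"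
        using z unfolding D_def by blast
      have "factors R V (\<lambda>F v. of_int (A F v)) (\<lambda>F. (1 - l) * x F + l * x' F) (\<lambda>v. (1 - l) * y v + l * y' v)"
        by (rule factors_cong[OF factors_add[OF factors_scale[OF xy(2), of "1 - l"] factors_scale[OF xy(4), of l]]])
           (use l in \<open>auto simp: algebra_simps\<close>)
      moreover have "(\<lambda>i. (1 - l) * z i + l * z' i) = case_sum (\<lambda>F. (1 - l) * x F + l * x' F) (\<lambda>v. (1 - l) * y v + l * y' v)"
        by (auto simp: fun_eq_iff xy split: sum.split)
      ultimately show ?thesis unfolding D_def by blast
    qed
    show "\<exists>z\<in>D. (\<Sum>i\<in>I. w i * z i) \<le> K" if w: "\<And>i. i \<in> I \<Longrightarrow> 0 < w i" "(\<Sum>i\<in>I. w i) = 1" for w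
    proof -
      have split: "(\<Sum>i\<in>I. f i) = (\<Sum>F\<in>R. f (Inl F)) + (\<Sum>v\<in>V. f (Inr v))" for f :: "'r + 'c \<Rightarrow> real"
        unfolding I_def using R V by (subst sum.union_disjoint) (auto simp: sum.reindex)
      have pos: "\<And>F. F \<in> R \<Longrightarrow> 0 < w (Inl F)" "\<And>v. v \<in> V \<Longrightarrow> 0 < w (Inr v)" using w(1) by (auto simp: I_def)
      have "(\<Sum>F\<in>R. w (Inl F)) \<ge> 0" "(\<Sum>v\<in>V. w (Inr v)) \<ge> 0"
        using pos by (auto intro!: sum_nonneg simp: less_imp_le)
      then have le: "(\<Sum>F\<in>R. w (Inl F)) \<le> 1" "(\<Sum>v\<in>V. w (Inr v)) \<le> 1"
        using w(2) unfolding split by auto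
      obtain x y where xy: "factors R V (\<lambda>F v. of_int (A F v)) x y"
        "(\<Sum>F\<in>R. w (Inl F) * x F) + (\<Sum>v\<in>V. w (Inr v) * y v) \<le> 36 * of_int h * (real L + 1)"
        using weighted_factorisation[OF R(1) pos(1) le(1) V less_imp_le[OF pos(2)] le(2) h L] by blast
      have "36 * of_int h * (real L + 1) \<le> 36 * of_int h * (9 / 2 * ln m)"
        using Lle h by (intro mult_left_mono) auto
      also have "\<dots> = K" by (simp add: K_def)
      finally show ?thesis using xy unfolding D_def
        by (intro bexI[of _ "case_sum x y"]) (auto simp: split)
    qed
  qed
  then obtain x y where "factors R V (\<lambda>F v. of_int (A F v)) x y" "\<forall>i\<in>I. case_sum x y i \<le> 3 * K"
    unfolding D_def by blast
  then show ?thesis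
    by (intro exI[of _ x] exI[of _ y]) (auto simp: I_def K_def m_def ball_Un)
qed

section \<open>Hereditary discrepancy of disjoint unions\<close>

theorem signing_of_factorisation:
  assumes fac: "factors R V A x y" and K: "K > 0" "\<And>F. F \<in> R \<Longrightarrow> x F \<le> K" "\<And>v. v \<in> V \<Longrightarrow> y v \<le> K"
    and R: "finite R" "card R \<ge> 2" and V: "finite V" and J: "J \<subseteq> V"
  shows "\<exists>s. (\<forall>j\<in>J. s j \<in> {-1, 1 :: real}) \<and>
    (\<forall>F\<in>R. \<bar>\<Sum>j\<in>J. A F j * s j\<bar> \<le> 8 * sqrt (ln (real (card R))) * K)"
proof -
  obtain N U W where UW: "factorisation R V A x y N U W"
    using fac unfolding factors_def by blast
  define m where "m = real (card R)"
  have m: "m \<ge> 2" using R by (simp add: m_def)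
  \<comment> \<open>For \<open>2 * m\<close> test vectors of squared length at most
    \<open>ln m\<close> the exponentials add up to at most \<open>2 * m * m ^ 6 \<le> m ^ 8\<close>.
    So each exponent is at most \<open>8 * ln m\<close>, and division by \<open>l\<close> leaves
    \<open>8 * sqrt (ln m)\<close>.\<close>
  define l where "l = sqrt (ln m)"
  have l: "l > 0" "l\<^sup>2 = ln m" using m by (auto simp: l_def)
  define v where "v j = fvec_of {..<N} (W j) /\<^sub>R sqrt K" for j
  define u where "u F = fvec_of {..<N} (U F) /\<^sub>R sqrt K" for F
  \<comment> \<open>Each row is tested with both signs \<sigma>, as an exponential bounds only one
    side.\<close>
  define \<theta> where "\<theta> = (\<lambda>(F, \<sigma>). (\<sigma> * l) *\<^sub>R u F)"
  have inn: "inner (fvec_of {..<N} f /\<^sub>R sqrt K) (fvec_of {..<N} g /\<^sub>R sqrt K) = (\<Sum>a<N. f a * g a) / K"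
    for f g :: "nat \<Rightarrow> real"
  proof -
    have "inverse (sqrt K) * inverse (sqrt K) = 1 / K"
      using K(1) by (simp add: field_simps)
    then show ?thesis by (simp add: inner_fvec_of_fvec_of flip: mult.assoc)
  qed
  have nf: "(norm (fvec_of {..<N} f /\<^sub>R sqrt K))\<^sup>2 = (\<Sum>a<N. (f a)\<^sup>2) / K" for f :: "nat \<Rightarrow> real"
    unfolding power2_norm_eq_inner inn by (simp add: power2_eq_square)
  have nv: "norm (v j) \<le> 1" if "j \<in> J" for j
  proof -
    have "(norm (v j))\<^sup>2 = y j / K" unfolding v_def nf using UW that J by (auto simp: factorisation_def)
    also have "\<dots> \<le> 1" using K that J by auto
    finally show ?thesis by (simp add: power_le_one_iff abs_square_le_1)
  qed
  have nu: "(norm (u F))\<^sup>2 \<le> 1" if "F \<in> R" for F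
  proof -
    have "(norm (u F))\<^sup>2 = x F / K" unfolding u_def nf using UW that by (auto simp: factorisation_def)
    also have "\<dots> \<le> 1" using K that by auto
    finally show ?thesis .
  qed
  have uv: "inner (u F) (v j) = A F j / K" if "F \<in> R" "j \<in> J" for F j
    unfolding u_def v_def inn using UW that J by (auto simp: factorisation_def)
  have finJ: "finite J" using J V finite_subset by blast
  have fin2: "finite (R \<times> {-1, 1 :: real})" using R by simp
  obtain s where s: "\<And>j. j \<in> J \<Longrightarrow> s j \<in> {-1, 1 :: real}"
    "(\<Sum>k\<in>R \<times> {-1, 1}. exp (inner (\<theta> k) (\<Sum>j\<in>J. s j *\<^sub>R v j))) \<le> (\<Sum>k\<in>R \<times> {-1, 1}. exp (6 * (norm (\<theta> k))\<^sup>2))"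
    by (rule subgaussian_signing[where K = "R \<times> {-1, 1}" and v = v and \<theta> = \<theta>, OF finJ]) (erule nv, rule that)
  have "(\<Sum>k\<in>R \<times> {-1, 1}. exp (6 * (norm (\<theta> k))\<^sup>2)) \<le> (\<Sum>k\<in>R \<times> {-1, 1 :: real}. exp (6 * ln m))"
  proof (intro sum_mono)
    fix k :: "'a \<times> real" assume "k \<in> R \<times> {-1, 1}"
    then obtain F \<sigma> where k: "k = (F, \<sigma>)" "F \<in> R" "\<sigma> \<in> {-1, 1}" by auto
    have "(norm (\<theta> k))\<^sup>2 = l\<^sup>2 * (norm (u F))\<^sup>2" using k by (auto simp: \<theta>_def power_mult_distrib)
    also have "\<dots> \<le> l\<^sup>2 * 1" using nu[OF k(2)] by (intro mult_left_mono) auto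
    finally show "exp (6 * (norm (\<theta> k))\<^sup>2) \<le> exp (6 * ln m)" using l by simp
  qed
  also have "\<dots> = 2 * m * exp (6 * ln m)" by (simp add: card_cartesian_product m_def)
  also have "\<dots> \<le> exp (8 * ln m)"
  proof -
    have "2 * m \<le> exp (ln m) * exp (ln m)" using m by simp
    then have "2 * m * exp (6 * ln m) \<le> (exp (ln m) * exp (ln m)) * exp (6 * ln m)"
      by (intro mult_right_mono) auto
    also have "\<dots> = exp (8 * ln m)" by (simp flip: exp_add)
    finally show ?thesis .
  qed
  finally have tot: "(\<Sum>k\<in>R \<times> {-1, 1}. exp (inner (\<theta> k) (\<Sum>j\<in>J. s j *\<^sub>R v j))) \<le> exp (8 * ln m)"
    using s(2) by linarith
  have one: "\<sigma> * (\<Sum>j\<in>J. A F j * s j) \<le> 8 * l * K" if F: "F \<in> R" and \<sigma>: "\<sigma> \<in> {-1, 1}" for F \<sigma>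
  proof -
    have "exp (inner (\<theta> (F, \<sigma>)) (\<Sum>j\<in>J. s j *\<^sub>R v j)) \<le> (\<Sum>k\<in>R \<times> {-1, 1}. exp (inner (\<theta> k) (\<Sum>j\<in>J. s j *\<^sub>R v j)))"
      using F \<sigma> fin2 by (intro member_le_sum) auto
    from order_trans[OF this tot] have "inner (\<theta> (F, \<sigma>)) (\<Sum>j\<in>J. s j *\<^sub>R v j) \<le> 8 * ln m"
      by (simp only: exp_le_cancel_iff)
    moreover have "inner (\<theta> (F, \<sigma>)) (\<Sum>j\<in>J. s j *\<^sub>R v j) = l * (\<sigma> * (\<Sum>j\<in>J. A F j * s j)) / K"
    proof -
      have "inner (u F) (\<Sum>j\<in>J. s j *\<^sub>R v j) = (\<Sum>j\<in>J. s j * (A F j / K))"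
        unfolding inner_sum_right by (rule sum.cong) (use uv[OF F] in auto)
      also have "\<dots> = (\<Sum>j\<in>J. A F j * s j) / K"
        by (simp add: sum_divide_distrib mult.commute)
      finally show ?thesis by (simp add: \<theta>_def)
    qed
    ultimately have "l * (\<sigma> * (\<Sum>j\<in>J. A F j * s j)) \<le> l * (8 * l * K)"
      using K(1) unfolding l(2)[symmetric] by (simp add: pos_divide_le_eq power2_eq_square mult_ac)
    then show ?thesis using l(1) by simp
  qed
  have "\<bar>\<Sum>j\<in>J. A F j * s j\<bar> \<le> 8 * l * K" if "F \<in> R" for F
    using one[OF that, of 1] one[OF that, of "-1"] by (simp add: abs_le_iff)
  then show ?thesis using s(1) unfolding l_def m_def by blast
qed

section \<open>Discrepancy as existence of colourings\<close>

lemma finite_colourings: "finite V \<Longrightarrow> finite (V \<rightarrow>\<^sub>E {-1, 1 :: int})"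
  by (simp add: finite_PiE)

lemma colourings_nonempty: "V \<rightarrow>\<^sub>E {-1, 1 :: int} \<noteq> {}"
  by (simp add: PiE_eq_empty_iff)

lemma disc_attained:
  assumes "finite V" "finite FF"
  shows "\<exists>x\<in>V \<rightarrow>\<^sub>E {-1, 1}. \<forall>F\<in>FF. \<bar>colsum x F\<bar> \<le> disc V FF"
proof -
  have "disc V FF \<in> (\<lambda>x. Max (insert 0 ((\<lambda>F. \<bar>colsum x F\<bar>) ` FF))) ` (V \<rightarrow>\<^sub>E {-1, 1})"
    unfolding disc_def using assms(1) colourings_nonempty by (intro Min_in) (auto intro: finite_colourings)
  then obtain x where "x \<in> V \<rightarrow>\<^sub>E {-1, 1}" "disc V FF = Max (insert 0 ((\<lambda>F. \<bar>colsum x F\<bar>) ` FF))"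
    by blast
  then show ?thesis using assms(2) by (intro bexI[of _ x]) auto
qed

lemma disc_le:
  assumes "finite V" "finite FF" "x \<in> V \<rightarrow>\<^sub>E {-1, 1}" "0 \<le> b" "\<And>F. F \<in> FF \<Longrightarrow> \<bar>colsum x F\<bar> \<le> b"
  shows "disc V FF \<le> b"
proof -
  have "disc V FF \<le> Max (insert 0 ((\<lambda>F. \<bar>colsum x F\<bar>) ` FF))"
    unfolding disc_def using assms(1,3) by (intro Min_le) (auto intro: finite_colourings)
  also have "\<dots> \<le> b" using assms by (intro Max.boundedI) auto
  finally show ?thesis .
qed

lemma disc_le_herdisc:
  assumes "finite V" "J \<subseteq> V"
  shows "disc J (restr FF J) \<le> herdisc V FF"
  unfolding herdisc_def using assms by (intro Max_ge) auto

lemma herdisc_le: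
  assumes "finite V" "\<And>J. J \<subseteq> V \<Longrightarrow> disc J (restr FF J) \<le> b"
  shows "herdisc V FF \<le> b"
  unfolding herdisc_def using assms by (intro Max.boundedI) auto

lemma hereditary_bound_herdisc:
  assumes V: "finite V" and FF: "FF \<subseteq> Pow V"
  shows "hereditary_bound FF V (\<lambda>F v. of_bool (v \<in> F)) (herdisc V FF)"
  unfolding hereditary_bound_def
proof (intro allI impI)
  fix J assume J: "J \<subseteq> V"
  have fin: "finite J" "finite (restr FF J)"
    using J V FF finite_subset[of FF "Pow V"] finite_subset[of J V] by (auto simp: restr_def)
  obtain x where x: "x \<in> J \<rightarrow>\<^sub>E {-1, 1}" "\<forall>F\<in>restr FF J. \<bar>colsum x F\<bar> \<le> disc J (restr FF J)"
    using disc_attained[OF fin] by blast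
  have "\<bar>\<Sum>j\<in>J. of_bool (j \<in> F) * x j\<bar> \<le> herdisc V FF" if "F \<in> FF" for F
  proof -
    have "(\<Sum>j\<in>J. of_bool (j \<in> F) * x j) = colsum x (F \<inter> J)"
      unfolding colsum_def using fin(1) by (simp add: of_bool_def if_distrib[of "\<lambda>c. c * _"] sum.inter_restrict[symmetric] Int_commute cong: if_cong)
    moreover have "F \<inter> J \<in> restr FF J" using that by (auto simp: restr_def)
    ultimately show ?thesis using x(2) disc_le_herdisc[OF V J, of FF] by fastforce
  qed
  then show "\<exists>\<xi>. (\<forall>j\<in>J. \<xi> j \<in> {-1, 1}) \<and> (\<forall>F\<in>FF. \<bar>\<Sum>j\<in>J. of_bool (j \<in> F) * \<xi> j\<bar> \<le> herdisc V FF)"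
    using x(1) by (intro exI[of _ x]) auto
qed

text \<open>Of two sets one is nonempty, and restricted to one of its points it has discrepancy 1.
  This supplies \<open>h \<ge> 1\<close>, by which \<open>2 * h + 1\<close> is absorbed into
  \<open>3 * h\<close>.\<close>

lemma herdisc_ge_1:
  assumes V: "finite V" and FF: "FF \<subseteq> Pow V" "card FF \<ge> 2"
  shows "herdisc V FF \<ge> 1"
proof -
  have "\<not> FF \<subseteq> {{}}" using FF(2) card_mono[of "{{}}" FF] by auto
  then obtain F v where Fv: "F \<in> FF" "v \<in> F" by blast
  then have "{v} \<subseteq> V" using FF by blast
  with hereditary_bound_herdisc[OF V FF(1)]
  obtain \<xi> where "\<forall>j\<in>{v}. \<xi> j \<in> {-1, 1}" "\<forall>F\<in>FF. \<bar>\<Sum>j\<in>{v}. of_bool (j \<in> F) * \<xi> j\<bar> \<le> herdisc V FF"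
    unfolding hereditary_bound_def by meson
  then show ?thesis using Fv by fastforce
qed

lemma herdisc_le_of_signings:
  fixes b :: real
  assumes V: "finite V" and FF: "FF \<subseteq> Pow V" and b: "0 \<le> b"
    and sg: "\<And>J. J \<subseteq> V \<Longrightarrow> \<exists>s. (\<forall>j\<in>J. s j \<in> {-1, 1 :: real}) \<and> (\<forall>F\<in>FF. \<bar>\<Sum>j\<in>J. of_bool (j \<in> F) * s j\<bar> \<le> b)"
  shows "real_of_int (herdisc V FF) \<le> b"
proof -
  have "herdisc V FF \<le> \<lfloor>b\<rfloor>"
  proof (rule herdisc_le[OF V])
    fix J assume J: "J \<subseteq> V"
    have fin: "finite J" "finite (restr FF J)"
      using J V FF finite_subset[of FF "Pow V"] finite_subset[of J V] by (auto simp: restr_def)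
    obtain s where s: "\<forall>j\<in>J. s j \<in> {-1, 1 :: real}" "\<And>F. F \<in> FF \<Longrightarrow> \<bar>\<Sum>j\<in>J. of_bool (j \<in> F) * s j\<bar> \<le> b"
      using sg[OF J] by blast
    define x where "x = (\<lambda>j\<in>J. if s j = 1 then 1 else - 1 :: int)"
    show "disc J (restr FF J) \<le> \<lfloor>b\<rfloor>"
    proof (rule disc_le[OF fin])
      show "x \<in> J \<rightarrow>\<^sub>E {-1, 1}" by (auto simp: x_def)
      show "0 \<le> \<lfloor>b\<rfloor>" using b by simp
      fix F' assume "F' \<in> restr FF J"
      then obtain F where F: "F \<in> FF" "F' = F \<inter> J" by (auto simp: restr_def)
      have "real_of_int (colsum x F') = (\<Sum>j\<in>F \<inter> J. s j)"
        unfolding colsum_def F(2) of_int_sum by (rule sum.cong) (use s(1) in \<open>auto simp: x_def\<close>)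
      also have "\<dots> = (\<Sum>j\<in>J. of_bool (j \<in> F) * s j)"
        using fin(1) by (simp add: of_bool_def if_distrib[of "\<lambda>c. c * _"] sum.inter_restrict[symmetric] Int_commute cong: if_cong)
      finally have "\<bar>real_of_int (colsum x F')\<bar> \<le> b" using s(2)[OF F(1)] by simp
      then show "\<bar>colsum x F'\<bar> \<le> \<lfloor>b\<rfloor>" by (simp add: le_floor_iff)
    qed
  qed
  then show ?thesis by (simp add: le_floor_iff)
qed

lemma herdisc_disjoint_union_bound:
  fixes V :: "'a set" and Fs :: "nat \<Rightarrow> 'a set set"
  assumes V: "finite V" and FF: "FF \<subseteq> Pow V" "card FF \<ge> 2"
    and Fs: "\<And>i. i \<in> {1..t} \<Longrightarrow> Fs i \<subseteq> Pow V" "\<And>i. i \<in> {1..t} \<Longrightarrow> card (Fs i) \<ge> 2"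
    and dec: "\<And>F. F \<in> FF \<Longrightarrow> \<exists>G. (\<forall>i\<in>{1..t}. G i \<in> Fs i) \<and>
      (\<forall>i\<in>{1..t}. \<forall>j\<in>{1..t}. i \<noteq> j \<longrightarrow> G i \<inter> G j = {}) \<and> F = (\<Union>i\<in>{1..t}. G i)"
  shows "real_of_int (herdisc V FF) \<le> 3888 * sqrt (ln (real (card FF))) *
    (\<Sum>i=1..t. ln (real (card (Fs i))) * real_of_int (herdisc V (Fs i)))"
proof -
  define \<kappa> where "\<kappa> i = ln (real (card (Fs i))) * real_of_int (herdisc V (Fs i))" for i
  define K where "K = 486 * (\<Sum>i=1..t. \<kappa> i)"
  have finFF: "finite FF" using V FF(1) finite_subset by blast
  define splits where "splits F G \<longleftrightarrow> (\<forall>i\<in>{1..t}. G i \<in> Fs i) \<and>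
      (\<forall>i\<in>{1..t}. \<forall>j\<in>{1..t}. i \<noteq> j \<longrightarrow> G i \<inter> G j = {}) \<and> F = (\<Union>i\<in>{1..t}. G i)" for F G
  have "\<forall>F\<in>FF. \<exists>G. splits F G"
    unfolding splits_def by (intro ballI dec)
  from bchoice[OF this] obtain G where G: "\<forall>F\<in>FF. splits F (G F)" ..
  have GFs: "G F i \<in> Fs i" if "F \<in> FF" "i \<in> {1..t}" for F i
    using bspec[OF G that(1)] that(2) unfolding splits_def by simp
  have disj: "G F i \<inter> G F j = {}" if "F \<in> FF" "i \<in> {1..t}" "j \<in> {1..t}" "i \<noteq> j" for F i j
    using bspec[OF G that(1)] that(2-) unfolding splits_def by simp
  have un: "v \<in> F \<longleftrightarrow> (\<exists>i\<in>{1..t}. v \<in> G F i)" if "F \<in> FF" for F v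
  proof -
    have "F = (\<Union>i\<in>{1..t}. G F i)" using bspec[OF G that] unfolding splits_def by (elim conjE)
    then have "v \<in> F \<longleftrightarrow> v \<in> (\<Union>i\<in>{1..t}. G F i)" by (rule arg_cong)
    then show ?thesis by simp
  qed
  define bound where "bound i xy \<longleftrightarrow> factors (Fs i) V (\<lambda>F v. of_int (of_bool (v \<in> F))) (fst xy) (snd xy) \<and>
      (\<forall>F\<in>Fs i. fst xy F \<le> 486 * \<kappa> i) \<and> (\<forall>v\<in>V. snd xy v \<le> 486 * \<kappa> i)" for i xy
  have "\<forall>i\<in>{1..t}. \<exists>xy. bound i xy"
  proof
    fix i assume i: "i \<in> {1..t}"
    have "finite (Fs i)" using finite_subset[OF Fs(1)[OF i]] V by simp
    from factorisation_of_hereditary_bound[OF this Fs(2)[OF i] V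
        herdisc_ge_1[OF V Fs(1)[OF i] Fs(2)[OF i]] hereditary_bound_herdisc[OF V Fs(1)[OF i]]]
    obtain x y where "factors (Fs i) V (\<lambda>F v. of_int (of_bool (v \<in> F))) x y \<and>
      (\<forall>F\<in>Fs i. x F \<le> 486 * \<kappa> i) \<and> (\<forall>v\<in>V. y v \<le> 486 * \<kappa> i)"
      unfolding \<kappa>_def[symmetric] by (elim exE) (rule that)
    then show "\<exists>xy. bound i xy" unfolding bound_def by (intro exI[of _ "(x, y)"]) simp
  qed
  from bchoice[OF this] obtain xy where xy: "\<forall>i\<in>{1..t}. bound i (xy i)" ..
  have xy1: "factors (Fs i) V (\<lambda>F v. of_int (of_bool (v \<in> F))) (fst (xy i)) (snd (xy i))"
    and xy2: "\<And>F. F \<in> Fs i \<Longrightarrow> fst (xy i) F \<le> 486 * \<kappa> i"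
    and xy3: "\<And>v. v \<in> V \<Longrightarrow> snd (xy i) v \<le> 486 * \<kappa> i" if "i \<in> {1..t}" for i
    using bspec[OF xy that] unfolding bound_def by simp_all
  have "factors FF V (\<lambda>F v. \<Sum>i\<in>{1..t}. of_int (of_bool (v \<in> G F i)))
      (\<lambda>F. \<Sum>i\<in>{1..t}. fst (xy i) (G F i)) (\<lambda>v. \<Sum>i\<in>{1..t}. snd (xy i) v)"
  proof (rule factors_sum)
    fix i assume i: "i \<in> {1..t}"
    show "factors FF V (\<lambda>F v. of_int (of_bool (v \<in> G F i))) (\<lambda>F. fst (xy i) (G F i)) (snd (xy i))"
      by (rule factors_reindex_rows[OF xy1[OF i]]) (rule GFs[OF _ i])
  qed simp
  then have fac: "factors FF V (\<lambda>F v. of_bool (v \<in> F))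
      (\<lambda>F. \<Sum>i\<in>{1..t}. fst (xy i) (G F i)) (\<lambda>v. \<Sum>i\<in>{1..t}. snd (xy i) v)"
  proof (rule factors_cong)
    fix F v assume F: "F \<in> FF" and "v \<in> V"
    show "(\<Sum>i\<in>{1..t}. of_int (of_bool (v \<in> G F i))) = (of_bool (v \<in> F) :: real)"
    proof (cases "v \<in> F")
      case True
      \<comment> \<open>By disjointness only the part \<open>G F j\<close> contains
        \<open>v\<close>, so the indicators of the parts add up to 1.\<close>
      then obtain j where j: "j \<in> {1..t}" "v \<in> G F j" using un[OF F] by blast
      have "(\<Sum>i\<in>{1..t}. of_int (of_bool (v \<in> G F i))) = (\<Sum>i\<in>{1..t}. if i = j then 1 else 0 :: real)"
        by (rule sum.cong) (use j disj[OF F _ j(1)] in auto)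
      then show ?thesis using True j by simp
    next
      case False
      then have "v \<notin> G F i" if "i \<in> {1..t}" for i using un[OF F] that by blast
      then show ?thesis using False by simp
    qed
  qed auto
  \<comment> \<open>Without parts every set of \<open>FF\<close> would be empty. A nonempty sum of
    positive terms makes \<open>K\<close> positive, as the rescaling by \<open>sqrt K\<close>
    requires.\<close>
  have "t \<ge> 1"
  proof (rule ccontr)
    assume "\<not> t \<ge> 1"
    then have "{1..t} = {}" by simp
    then have "F = {}" if "F \<in> FF" for F using un[OF that] by auto
    then have "card FF \<le> card {{} :: 'a set}" by (intro card_mono) auto
    then show False using FF(2) by simp
  qed
  moreover have "\<kappa> i > 0" if "i \<in> {1..t}" for i
    using Fs(2)[OF that] herdisc_ge_1[OF V Fs(1)[OF that] Fs(2)[OF that]] by (simp add: \<kappa>_def)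
  ultimately have K: "K > 0" unfolding K_def by (intro mult_pos_pos sum_pos) auto
  have "real_of_int (herdisc V FF) \<le> 8 * sqrt (ln (real (card FF))) * K"
  proof (rule herdisc_le_of_signings[OF V FF(1)])
    show "0 \<le> 8 * sqrt (ln (real (card FF))) * K" using K FF(2) by simp
    fix J assume "J \<subseteq> V"
    show "\<exists>s. (\<forall>j\<in>J. s j \<in> {-1, 1 :: real}) \<and>
        (\<forall>F\<in>FF. \<bar>\<Sum>j\<in>J. of_bool (j \<in> F) * s j\<bar> \<le> 8 * sqrt (ln (real (card FF))) * K)"
    proof (rule signing_of_factorisation[OF fac K _ _ finFF FF(2) V \<open>J \<subseteq> V\<close>])
      show "(\<Sum>i\<in>{1..t}. fst (xy i) (G F i)) \<le> K" if "F \<in> FF" for F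
        unfolding K_def sum_distrib_left by (intro sum_mono xy2 GFs that)
      show "(\<Sum>i\<in>{1..t}. snd (xy i) v) \<le> K" if "v \<in> V" for v
        unfolding K_def sum_distrib_left by (intro sum_mono xy3 that)
    qed
  qed
  then show ?thesis by (simp add: K_def \<kappa>_def mult_ac)
qed

theorem theorem5p2:
  shows "\<exists>C::real. C > 0 \<and>
    (\<forall>(V::nat set) (t::nat) (Fs::nat \<Rightarrow> nat set set) (FF::nat set set).
       finite V \<longrightarrow> FF \<subseteq> Pow V \<longrightarrow> (\<forall>i\<in>{1..t}. Fs i \<subseteq> Pow V) \<longrightarrow>
       card FF \<ge> 2 \<longrightarrow> (\<forall>i\<in>{1..t}. card (Fs i) \<ge> 2) \<longrightarrow>
       (\<forall>F\<in>FF. \<exists>G::nat \<Rightarrow> nat set.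
          (\<forall>i\<in>{1..t}. G i \<in> Fs i) \<and>
          (\<forall>i\<in>{1..t}. \<forall>j\<in>{1..t}. i \<noteq> j \<longrightarrow> G i \<inter> G j = {}) \<and>
          F = (\<Union>i\<in>{1..t}. G i)) \<longrightarrow>
       real_of_int (herdisc V FF)
         \<le> C * sqrt (ln (real (card FF))) *
             (\<Sum>i=1..t. ln (real (card (Fs i))) * real_of_int (herdisc V (Fs i))))"
proof (intro exI[of _ 3888] conjI allI impI)
  fix V :: "nat set" and t :: nat and Fs :: "nat \<Rightarrow> nat set set" and FF :: "nat set set"
  assume "finite V" "FF \<subseteq> Pow V" "\<forall>i\<in>{1..t}. Fs i \<subseteq> Pow V" "card FF \<ge> 2" "\<forall>i\<in>{1..t}. card (Fs i) \<ge> 2"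
    "\<forall>F\<in>FF. \<exists>G::nat \<Rightarrow> nat set. (\<forall>i\<in>{1..t}. G i \<in> Fs i) \<and>
       (\<forall>i\<in>{1..t}. \<forall>j\<in>{1..t}. i \<noteq> j \<longrightarrow> G i \<inter> G j = {}) \<and> F = (\<Union>i\<in>{1..t}. G i)"
  then show "real_of_int (herdisc V FF) \<le> 3888 * sqrt (ln (real (card FF))) *
      (\<Sum>i=1..t. ln (real (card (Fs i))) * real_of_int (herdisc V (Fs i)))"
    by (intro herdisc_disjoint_union_bound) simp_all
qed simp

end
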